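(* Assume A1, A2, A3, A4 and A5 (stated in the context). Then, as $k\to\infty$, $$\operatorname{dist}(u,\ \mathbf{K}\cap\mathbf{B}^m_{\mathfrak{R}})=O\left(\frac{\log k}{k}\right)\ \text{ for all } u\in\Lambda_k \quad\text{(uniformly in } u\in\Lambda_k),\qquad\text{and}\qquad 0\le r^{\star}-r_k^{\mathrm{dual}}=O\left(\frac{\log k}{k}\right).$$
   Context: Problem. Let $x=(x_1,\dots,x_m)$, $y=(y_1,\dots,y_n)$, $f,g,\varphi_1,\dots,\varphi_s\in\mathbb{R}[x]$, $p\in\mathbb{R}[x,y]$, $\mathbf{Y}\subset\mathbb{R}^n$. The problem (FSIPP) is $$r^{\star}:=\min_{x\in\mathbb{R}^m} \frac{f(x)}{g(x)}\quad\text{s.t. } \varphi_1(x)\le 0,\dots,\varphi_s(x)\le 0,\quad p(x,y)\le 0\ \ \forall y\in\mathbf{Y}.$$ $\mathbf{K}$ is its feasible set and $\mathbf{S}$ its set of optimal solutions; it is assumed throughout that $\mathbf{S}\ne\emptyset$. A polynomial $h\in\mathbb{R}[x]$ is sos-convex if there are an integer $r$ and a matrix polynomial $H\in\mathbb{R}[x]^{r\times m}$ with $\nabla^2h=H(x)^TH(x)$. Fixed constants $\mathfrak{R}>0$ and $g^{\star}>0$ are such that $\|u^{\star}\|\le\mathfrak{R}$ and $g(u^{\star})\ge g^{\star}$ for some $u^{\star}\in\mathbf{S}$. $\mathbf{B}^m_{\mathfrak{R}}$ is the closed Euclidean ball of radius $\mathfrak{R}$ centered at the origin of $\mathbb{R}^m$;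 $\mathbf{B}^n_\delta(y)$ is the ball of radius $\delta$ centered at $y$ in $\mathbb{R}^n$, $\mathbf{B}^n$ the unit ball of $\mathbb{R}^n$, and $\mathrm{vol}$ is Lebesgue measure. Assumptions. A1: (i) $\mathbf{Y}\subseteq[-1,1]^n$ and $\mathbf{Y}$ is closed; (ii) $\varphi_1,\dots,\varphi_s$ and $p(\cdot,y)$ for every $y\in\mathbf{Y}$ are sos-convex. A2: (i) $f$ and $-g$ are sos-convex; (ii) either $f(x)\ge0$ and $g(x)>0$ for all $x\in\mathbf{K}$, or $g$ is affine and $g(x)>0$ for all $x\in\mathbf{K}$. A3 (Slater): there is $u\in\mathbf{K}$ with $p(u,y)<0$ for all $y\in\mathbf{Y}$ and $\varphi_j(u)<0$ for $j=1,\dots,s$. A4: there is $\bar x\in\mathbb{R}^m$ with $\|\bar x\|<\mathfrak{R}$ and $p(\bar x,y)<0$ for all $y\in\mathbf{Y}$. A5: there are constants $\epsilon_{\mathbf{Y}},\eta_{\mathbf{Y}}>0$ such that $\mathrm{vol}(\mathbf{B}^n_\delta(y)\cap\mathbf{Y})\ge\eta_{\mathbf{Y}}\,\mathrm{vol}(\mathbf{B}^n_\delta(y))=\delta^n\eta_{\mathbf{Y}}\,\mathrm{vol}(\mathbf{B}^n)$ for all $y\in\mathbf{Y}$ and $0<\delta<\epsilon_{\mathbf{Y}}$. Notation. $\mathbb{N}$ is the set of nonnegative integers. $\mathbb{R}[x]_k$, $\mathbb{R}[y]_k$: polynomials of degree at most $k$; $A^*$ is the space of linear functionals on a vector space $A$,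 and $C^*$ for a convex cone $C$ is the dual cone of linear functionals nonnegative on $C$. $\Sigma^2[x]$: sums of squares of polynomials; $\Sigma^2_k[x]$ (resp. $\Sigma^2_k[y]$): sums of squares of degree at most $2k$. $d_y:=\deg_y p(x,y)$, and $\mathbf{d}:=\lceil\max\{\deg f,\deg g,\deg\varphi_1,\dots,\deg\varphi_s,\deg_x p(x,y)\}/2\rceil$ (with $\mathbf{d}\ge1$). For $\mathscr{L}\in(\mathbb{R}[x]_{2\mathbf{d}})^*$, $\mathscr{L}(x):=(\mathscr{L}(x_1),\dots,\mathscr{L}(x_m))\in\mathbb{R}^m$, and $\mathscr{L}(p(x,y))\in\mathbb{R}[y]$ is obtained by applying $\mathscr{L}$ to $p$ viewed as a polynomial in $x$ with coefficients in $\mathbb{R}[y]$. $\operatorname{dist}$ is Euclidean distance from a point to a set. It is assumed that the Lebesgue measure restricted to $\mathbf{Y}$ has support exactly $\mathbf{Y}$, and for $k\in\mathbb{N}$ $$\mathcal{P}^k(\mathbf{Y}):=\Big\{\psi\in\mathbb{R}[y]_{d_y}\ \Big|\ \int_{\mathbf{Y}}\psi(y)\sigma(y)\,dy\ge0\ \ \forall\sigma\in\Sigma^2_k[y]\Big\}.$$ $\Lambda_k\subset\mathbb{R}^m$ is the set of all points $\mathscr{L}(x)$ where $\mathscr{L}\in(\mathbb{R}[x]_{2\mathbf{d}})^*$ satisfies: $\mathscr{L}(\sigma_0)\ge0$ for all $\sigma_0\in\Sigma^2_{\mathbf{d}}[x]$; $\mathscr{L}((\mathfrak{R}^2-\|x\|^2)\sigma)\ge0$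 for all $\sigma\in\Sigma^2_{\mathbf{d}-1}[x]$; $-\mathscr{L}(p(x,y))\in\mathcal{P}^k(\mathbf{Y})$; $\mathscr{L}(1)=1$; $\mathscr{L}(\varphi_j)\le0$ for $j=1,\dots,s$. Put $q_0=1$, $q_1=\mathfrak{R}^2-\|x\|^2$, $q_2=g-g^{\star}$, $Q=\{q_1,q_2\}$, and $\mathbf{M}_{\mathbf{d}}(Q):=\{\sum_{j=0}^2\sigma_jq_j\mid\sigma_j\in\Sigma^2[x],\ \deg(\sigma_jq_j)\le2\mathbf{d}\}$. Then $$r_k^{\mathrm{dual}}:=\inf_{\mathscr{L}\in(\mathbb{R}[x]_{2\mathbf{d}})^*}\mathscr{L}(f)\quad\text{s.t. }\mathscr{L}\in(\mathbf{M}_{\mathbf{d}}(Q))^*,\ \mathscr{L}(g)=1,\ -\mathscr{L}(p(x,y))\in\mathcal{P}^k(\mathbf{Y}),\ \mathscr{L}(\varphi_j)\le0\ (j=1,\dots,s).$$ *)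

theory Defs
  imports "HOL-Analysis.Analysis" "HOL-Library.Poly_Mapping"
begin

section \<open>Multivariate polynomials\<close>

text \<open>
  A polynomial with coefficients in \<open>'a\<close> and variables indexed by \<open>'v\<close> is a finitely supported
  map from exponent vectors to coefficients; the ring operations are the convolution ones of
  \<^theory>\<open>HOL-Library.Poly_Mapping\<close>.  The polynomial ring \<open>\<real>[x,y]\<close> is represented as
  \<open>\<real>[y][x]\<close>, that is, as polynomials in \<open>x\<close> whose coefficients are polynomials in \<open>y\<close>.
\<close>

type_synonym ('v, 'a) mpoly = "('v \<Rightarrow>\<^sub>0 nat) \<Rightarrow>\<^sub>0 'a"

definition mono_deg :: "('v::finite \<Rightarrow>\<^sub>0 nat) \<Rightarrow> nat" where
  "mono_deg \<alpha> = (\<Sum>i\<in>UNIV. Poly_Mapping.lookup \<alpha> i)"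

text \<open>Total degree, with the convention that the zero polynomial has degree 0.\<close>

definition mdeg :: "('v::finite, 'a::zero) mpoly \<Rightarrow> nat" where
  "mdeg h = Max (insert 0 (mono_deg ` Poly_Mapping.keys h))"

definition mconst :: "'a::zero \<Rightarrow> ('v, 'a) mpoly" where
  "mconst c = Poly_Mapping.single 0 c"

definition mvar :: "'v \<Rightarrow> ('v, 'a::zero_neq_one) mpoly" where
  "mvar i = Poly_Mapping.single (Poly_Mapping.single i 1) 1"

definition peval :: "('v::finite, real) mpoly \<Rightarrow> real ^ 'v \<Rightarrow> real" where
  "peval h x = (\<Sum>\<alpha>\<in>Poly_Mapping.keys h.
      Poly_Mapping.lookup h \<alpha> * (\<Prod>i\<in>UNIV. (x $ i) ^ Poly_Mapping.lookup \<alpha> i))"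

text \<open>
  Formal partial derivative.  The exponent subtraction is truncated, which only matters for
  terms whose new coefficient is 0.
\<close>

definition pderiv_at :: "'v \<Rightarrow> ('v, real) mpoly \<Rightarrow> ('v, real) mpoly" where
  "pderiv_at i h = (\<Sum>\<alpha>\<in>Poly_Mapping.keys h.
      Poly_Mapping.single (\<alpha> - Poly_Mapping.single i 1)
        (of_nat (Poly_Mapping.lookup \<alpha> i) * Poly_Mapping.lookup h \<alpha>))"

definition sqnorm_poly :: "('v::finite, real) mpoly" where
  "sqnorm_poly = (\<Sum>i\<in>UNIV. mvar i ^ 2)"

text \<open>For \<open>p \<in> \<real>[x,y]\<close>: the polynomial \<open>p(\<cdot>,y) \<in> \<real>[x]\<close>, and the degree of \<open>p\<close> in \<open>y\<close>
  (the degree in \<open>x\<close> is \<^const>\<open>mdeg\<close>).\<close>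

definition at_y :: "('m, ('n::finite, real) mpoly) mpoly \<Rightarrow> real ^ 'n \<Rightarrow> ('m, real) mpoly" where
  "at_y p y = Poly_Mapping.map (\<lambda>c. peval c y) p"

definition mdeg_y :: "('m, ('n::finite, real) mpoly) mpoly \<Rightarrow> nat" where
  "mdeg_y p = Max (insert 0 ((\<lambda>\<alpha>. mdeg (Poly_Mapping.lookup p \<alpha>)) ` Poly_Mapping.keys p))"

definition polys_le :: "nat \<Rightarrow> ('v::finite, real) mpoly set" where
  "polys_le k = {h. mdeg h \<le> k}"

section \<open>Sums of squares and sos-convexity\<close>

definition sos :: "('v, real) mpoly set" where
  "sos = {h. \<exists>(r::nat) q. h = (\<Sum>l<r. q l ^ 2)}"

definition sos_le :: "nat \<Rightarrow> ('v::finite, real) mpoly set" where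
  "sos_le k = {\<sigma> \<in> sos. mdeg \<sigma> \<le> 2 * k}"

text \<open>\<open>H\<close> is a matrix polynomial with \<open>r\<close> rows, and the equation is \<open>\<nabla>\<^sup>2h = H\<^sup>T H\<close> entrywise.\<close>

definition sos_convex :: "('v, real) mpoly \<Rightarrow> bool" where
  "sos_convex h \<longleftrightarrow> (\<exists>(r::nat) (H :: nat \<Rightarrow> 'v \<Rightarrow> ('v, real) mpoly).
      \<forall>i j. pderiv_at i (pderiv_at j h) = (\<Sum>l<r. H l i * H l j))"

section \<open>The fractional semi-infinite problem\<close>

definition feasible_set ::
  "(nat \<Rightarrow> ('m::finite, real) mpoly) \<Rightarrow> nat \<Rightarrow> ('m, ('n::finite, real) mpoly) mpoly
    \<Rightarrow> (real ^ 'n) set \<Rightarrow> (real ^ 'm) set" where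
  "feasible_set \<phi> s p Y =
     {x. (\<forall>j\<in>{1..s}. peval (\<phi> j) x \<le> 0) \<and> (\<forall>y\<in>Y. peval (at_y p y) x \<le> 0)}"

definition optimal_set ::
  "('m::finite, real) mpoly \<Rightarrow> ('m, real) mpoly \<Rightarrow> (real ^ 'm) set \<Rightarrow> (real ^ 'm) set" where
  "optimal_set f g K =
     {u \<in> K. \<forall>x\<in>K. peval f u / peval g u \<le> peval f x / peval g x}"

definition optimal_value ::
  "('m::finite, real) mpoly \<Rightarrow> ('m, real) mpoly \<Rightarrow> (real ^ 'm) set \<Rightarrow> ereal" where
  "optimal_value f g K = (INF x\<in>K. ereal (peval f x / peval g x))"

definition half_degree ::
  "('m::finite, real) mpoly \<Rightarrow> ('m, real) mpoly \<Rightarrow> (nat \<Rightarrow> ('m, real) mpoly) \<Rightarrow> nat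
    \<Rightarrow> ('m, ('n, real) mpoly) mpoly \<Rightarrow> nat" where
  "half_degree f g \<phi> s p =
     nat \<lceil>real (Max ({mdeg f, mdeg g, mdeg p} \<union> (\<lambda>j. mdeg (\<phi> j)) ` {1..s})) / 2\<rceil>"

definition measure_support :: "'a::topological_space measure \<Rightarrow> 'a set" where
  "measure_support M = {y. \<forall>U. open U \<and> y \<in> U \<longrightarrow> emeasure M U > 0}"

section \<open>The relaxations\<close>

text \<open>
  Linear functionals on \<open>\<real>[x]\<^sub>k\<close>.  A functional is a total HOL function of which only the
  values on \<^term>\<open>polys_le k\<close> are constrained and used.
\<close>

definition linear_functional :: "nat \<Rightarrow> (('m::finite, real) mpoly \<Rightarrow> real) \<Rightarrow> bool" where
  "linear_functional k L \<longleftrightarrow>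
     (\<forall>a\<in>polys_le k. \<forall>b\<in>polys_le k. L (a + b) = L a + L b) \<and>
     (\<forall>c. \<forall>a\<in>polys_le k. L (mconst c * a) = c * L a)"

text \<open>\<open>L(p(x,y)) \<in> \<real>[y]\<close> for \<open>p = \<Sum>\<alpha>. p\<^sub>\<alpha>(y) x\<^sup>\<alpha>\<close> is \<open>\<Sum>\<alpha>. L(x\<^sup>\<alpha>) p\<^sub>\<alpha>(y)\<close>.\<close>

definition apply_x ::
  "(('m, real) mpoly \<Rightarrow> real) \<Rightarrow> ('m, ('n, real) mpoly) mpoly \<Rightarrow> ('n, real) mpoly" where
  "apply_x L p = (\<Sum>\<alpha>\<in>Poly_Mapping.keys p.
      mconst (L (Poly_Mapping.single \<alpha> 1)) * Poly_Mapping.lookup p \<alpha>)"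

definition point_of :: "(('m::finite, real) mpoly \<Rightarrow> real) \<Rightarrow> real ^ 'm" where
  "point_of L = (\<chi> i. L (mvar i))"

definition Pk :: "nat \<Rightarrow> (real ^ 'n) set \<Rightarrow> nat \<Rightarrow> ('n::finite, real) mpoly set" where
  "Pk dy Y k = {\<psi> \<in> polys_le dy. \<forall>\<sigma>\<in>sos_le k. (LINT y:Y|lborel. peval \<psi> y * peval \<sigma> y) \<ge> 0}"

definition Lambda ::
  "(nat \<Rightarrow> ('m::finite, real) mpoly) \<Rightarrow> nat \<Rightarrow> ('m, ('n::finite, real) mpoly) mpoly
    \<Rightarrow> (real ^ 'n) set \<Rightarrow> real \<Rightarrow> nat \<Rightarrow> nat \<Rightarrow> (real ^ 'm) set" where
  "Lambda \<phi> s p Y R d k = {point_of L | L. linear_functional (2 * d) L \<and>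
      (\<forall>\<sigma>\<in>sos_le d. L \<sigma> \<ge> 0) \<and>
      (\<forall>\<sigma>\<in>sos_le (d - 1). L ((mconst (R\<^sup>2) - sqnorm_poly) * \<sigma>) \<ge> 0) \<and>
      - apply_x L p \<in> Pk (mdeg_y p) Y k \<and>
      L 1 = 1 \<and>
      (\<forall>j\<in>{1..s}. L (\<phi> j) \<le> 0)}"

definition quad_module_le ::
  "nat \<Rightarrow> ('m, real) mpoly \<Rightarrow> ('m, real) mpoly \<Rightarrow> ('m::finite, real) mpoly set" where
  "quad_module_le d q1 q2 = {\<sigma>0 + \<sigma>1 * q1 + \<sigma>2 * q2 | \<sigma>0 \<sigma>1 \<sigma>2.
      \<sigma>0 \<in> sos \<and> \<sigma>1 \<in> sos \<and> \<sigma>2 \<in> sos \<and>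
      mdeg \<sigma>0 \<le> 2 * d \<and> mdeg (\<sigma>1 * q1) \<le> 2 * d \<and> mdeg (\<sigma>2 * q2) \<le> 2 * d}"

definition r_dual ::
  "('m::finite, real) mpoly \<Rightarrow> ('m, real) mpoly \<Rightarrow> (nat \<Rightarrow> ('m, real) mpoly) \<Rightarrow> nat
    \<Rightarrow> ('m, ('n::finite, real) mpoly) mpoly \<Rightarrow> (real ^ 'n) set \<Rightarrow> real \<Rightarrow> real \<Rightarrow> nat \<Rightarrow> nat
    \<Rightarrow> ereal" where
  "r_dual f g \<phi> s p Y R gstar d k =
     (INF L \<in> {L. linear_functional (2 * d) L \<and>
          (\<forall>h \<in> quad_module_le d (mconst (R\<^sup>2) - sqnorm_poly) (g - mconst gstar). L h \<ge> 0) \<and>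
          L g = 1 \<and>
          - apply_x L p \<in> Pk (mdeg_y p) Y k \<and>
          (\<forall>j\<in>{1..s}. L (\<phi> j) \<le> 0)}. ereal (L f))"

end

theory Submission
  imports Defs
begin

text \<open>
  Let \<open>L\<close> be feasible for a relaxation, normalized to \<open>L 1 = 1\<close>, and let \<open>u = L(x)\<close>.  Jensen's
  inequality for sos-convex polynomials gives \<open>\<phi>\<^sub>j(u) \<le> 0\<close> and \<open>p(u,y) \<le> - \<psi>(y)\<close> with
  \<open>\<psi> = - L(p(x,y))\<close> in the relaxed cone.  Testing \<open>\<psi>\<close> against the square of a Chebyshev polynomial
  of \<open>\<psi>\<close> shows \<open>\<psi> \<ge> - C (log k / k)\<^sup>2\<close> on \<open>Y\<close>; the constant is uniform because the ball
  constraint bounds the moments of \<open>L\<close>.  A convex combination with a Slater point then moves \<open>u\<close> into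
  \<open>K\<close> over a distance \<open>O((log k / k)\<^sup>2)\<close>, which settles the optimal values.  There need not be a point
  of \<open>K\<close> in the open ball, so passing from \<open>K\<close> to \<open>K \<inter> B\<^sub>R\<close> may cost a square root; this is where
  the rate \<open>log k / k\<close> comes from.
\<close>

section \<open>Polynomials and their values\<close>

text \<open>The squared logarithm comes from the growth of Chebyshev polynomials just outside
  [-1, 1]: at 1 + h / 2 the one of degree j is at least (1 + sqrt h) ^ j / 2. If \<psi> fell below a
  multiple of - h somewhere on Y, the test square with j proportional to k would be that large on a
  ball of radius proportional to h around the minimizer. By A5 the part of Y in this ball has volume
  at least of order h ^ n, so the integral turns negative once the growth beats a power of 1 / h.
  This happens as soon as sqrt h is a large multiple of log k / k.

  For Jensen's inequality the obstacle is that L is linear and positive only up to degree 2 d. The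
  polynomial is therefore expanded along the line from u to the formal variable, with coefficients
  that keep the degree bound.

  For the optimal values L is normalized by L g = 1 instead of L 1 = 1, so L 1 has to be kept
  positive and bounded. There the repaired point only has to lie in K and not in the ball, hence no
  square root is lost.\<close>

abbreviation "lookup \<equiv> Poly_Mapping.lookup"
abbreviation "single \<equiv> Poly_Mapping.single"
abbreviation "keys \<equiv> Poly_Mapping.keys"

definition mono_val :: "('v::finite \<Rightarrow>\<^sub>0 nat) \<Rightarrow> real ^ 'v \<Rightarrow> real" where
  "mono_val \<alpha> x = (\<Prod>i\<in>UNIV. (x $ i) ^ lookup \<alpha> i)"

lemma mono_val_0 [simp]: "mono_val 0 x = 1"
  by (simp add: mono_val_def)

lemma mono_val_add: "mono_val (\<alpha> + \<beta>) x = mono_val \<alpha> x * mono_val \<beta> x"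
  by (simp add: mono_val_def lookup_add power_add prod.distrib)

lemma mono_val_single [simp]: "mono_val (single i n) x = (x $ i) ^ n"
proof -
  have "mono_val (single i n) x = (\<Prod>j\<in>UNIV. if j = i then (x $ i) ^ n else 1)"
    unfolding mono_val_def by (rule prod.cong) (auto simp: lookup_single when_def)
  then show ?thesis by simp
qed

lemma mono_deg_0 [simp]: "mono_deg 0 = 0"
  by (simp add: mono_deg_def)

lemma mono_deg_add: "mono_deg (\<alpha> + \<beta>) = mono_deg \<alpha> + mono_deg \<beta>"
  by (simp add: mono_deg_def lookup_add sum.distrib)

lemma mono_deg_single [simp]: "mono_deg (single i n) = n"
proof -
  have "mono_deg (single i n) = (\<Sum>j\<in>UNIV. if j = i then n else 0)"
    unfolding mono_deg_def by (rule sum.cong) (auto simp: lookup_single when_def)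
  then show ?thesis by simp
qed

lemma mono_deg_eq_0_iff [simp]: "mono_deg \<alpha> = 0 \<longleftrightarrow> \<alpha> = 0"
  by (auto simp: mono_deg_def intro: poly_mapping_eqI)

lemma mono_split_single:
  assumes "mono_deg \<alpha> \<noteq> 0"
  obtains i \<beta> where "\<alpha> = \<beta> + single i 1" "mono_deg \<alpha> = Suc (mono_deg \<beta>)"
proof -
  from assms have "\<alpha> \<noteq> 0" by simp
  then obtain i where i: "lookup \<alpha> i \<noteq> 0"
    by (metis lookup_zero poly_mapping_eqI)
  have "\<alpha> = (\<alpha> - single i 1) + single i 1"
    by (rule poly_mapping_eqI) (use i in \<open>auto simp: lookup_add lookup_minus lookup_single when_def\<close>)
  moreover from this have "mono_deg \<alpha> = Suc (mono_deg (\<alpha> - single i 1))"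
    using mono_deg_add[of "\<alpha> - single i 1" "single i 1"] by simp
  ultimately show thesis by (rule that)
qed

lemma mono_induct [case_names zero add]:
  assumes "P 0" and "\<And>\<alpha> i. P \<alpha> \<Longrightarrow> P (\<alpha> + single i 1)"
  shows "P (\<alpha> :: 'v::finite \<Rightarrow>\<^sub>0 nat)"
proof (induction "mono_deg \<alpha>" arbitrary: \<alpha>)
  case 0
  then show ?case using assms(1) by (metis mono_deg_eq_0_iff)
next
  case (Suc n)
  then obtain i \<beta> where "\<alpha> = \<beta> + single i 1" "mono_deg \<alpha> = Suc (mono_deg \<beta>)"
    by (metis mono_split_single nat.distinct(1))
  with Suc show ?case using assms(2) by simp
qed

text \<open>Cutting a monomial of degree at most 2 d into halves of degree at most d is what the
  Cauchy-Schwarz argument in \<open>moment_bound\<close> needs.\<close>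

lemma mono_split_degree:
  assumes "mono_deg \<alpha> \<le> k + l"
  obtains \<beta> \<gamma> where "\<alpha> = \<beta> + \<gamma>" "mono_deg \<beta> \<le> k" "mono_deg \<gamma> \<le> l"
proof -
  have "\<exists>\<beta> \<gamma>. \<alpha> = \<beta> + \<gamma> \<and> mono_deg \<beta> \<le> k \<and> mono_deg \<gamma> \<le> l"
    using assms
  proof (induction \<alpha> arbitrary: k l rule: mono_induct)
    case zero
    then show ?case by (intro exI[of _ 0]) simp
  next
    case (add \<alpha> i)
    have d: "mono_deg \<alpha> + 1 \<le> k + l" using add.prems by (simp add: mono_deg_add)
    show ?case
    proof (cases l)
      case 0
      with add.prems show ?thesis
        by (intro exI[of _ "\<alpha> + single i 1"] exI[of _ 0]) auto
    next
      case (Suc l')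
      with d have "mono_deg \<alpha> \<le> k + l'" by simp
      from add.IH[OF this] obtain \<beta> \<gamma>
        where "\<alpha> = \<beta> + \<gamma>" "mono_deg \<beta> \<le> k" "mono_deg \<gamma> \<le> l'" by blast
      with Suc show ?thesis
        by (intro exI[of _ \<beta>] exI[of _ "\<gamma> + single i 1"]) (simp add: mono_deg_add add.assoc)
    qed
  qed
  then show thesis using that by blast
qed

lemma poly_mapping_sum_single:
  assumes "finite A" "keys h \<subseteq> A"
  shows "h = (\<Sum>\<alpha>\<in>A. single \<alpha> (lookup h \<alpha>))"
proof (rule poly_mapping_eqI)
  fix k
  have "lookup (\<Sum>\<alpha>\<in>A. single \<alpha> (lookup h \<alpha>)) k = (\<Sum>\<alpha>\<in>A. if \<alpha> = k then lookup h \<alpha> else 0)"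
    by (simp add: lookup_sum lookup_single when_def)
  also have "\<dots> = lookup h k"
    using assms by (auto simp: in_keys_iff)
  finally show "lookup h k = lookup (\<Sum>\<alpha>\<in>A. single \<alpha> (lookup h \<alpha>)) k" by simp
qed

section \<open>Degree bounds under the ring operations\<close>

lemma mdeg_le_iff: "mdeg h \<le> k \<longleftrightarrow> (\<forall>\<alpha>\<in>keys h. mono_deg \<alpha> \<le> k)"
  by (auto simp: mdeg_def)

lemma polys_le_iff: "h \<in> polys_le k \<longleftrightarrow> (\<forall>\<alpha>\<in>keys h. mono_deg \<alpha> \<le> k)"
  by (simp add: polys_le_def mdeg_le_iff)

lemma polys_le_mono: "h \<in> polys_le k \<Longrightarrow> k \<le> l \<Longrightarrow> h \<in> polys_le l"
  by (auto simp: polys_le_def)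

lemma polys_le_0 [simp]: "0 \<in> polys_le k"
  by (simp add: polys_le_iff)

lemma polys_le_single: "mono_deg \<alpha> \<le> k \<Longrightarrow> single \<alpha> c \<in> polys_le k"
  by (auto simp: polys_le_iff)

lemma polys_le_mconst [simp]: "mconst c \<in> polys_le k"
  by (simp add: mconst_def polys_le_single)

lemma polys_le_1 [simp]: "1 \<in> polys_le k"
  by (simp add: polys_le_iff)

lemma polys_le_mvar: "1 \<le> k \<Longrightarrow> mvar i \<in> polys_le k"
  by (simp add: mvar_def polys_le_single)

lemma polys_le_add: "a \<in> polys_le k \<Longrightarrow> b \<in> polys_le k \<Longrightarrow> a + b \<in> polys_le k"
  using keys_add[of a b] unfolding polys_le_iff by blast

lemma polys_le_uminus: "- a \<in> polys_le k \<longleftrightarrow> a \<in> polys_le k"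
  by (simp add: polys_le_iff in_keys_iff)

lemma polys_le_diff: "a \<in> polys_le k \<Longrightarrow> b \<in> polys_le k \<Longrightarrow> a - b \<in> polys_le k"
  using polys_le_add[of a k "- b"] by (simp add: polys_le_uminus)

lemma polys_le_sum: "(\<And>i. i \<in> A \<Longrightarrow> f i \<in> polys_le k) \<Longrightarrow> sum f A \<in> polys_le k"
  by (induction A rule: infinite_finite_induct) (auto intro: polys_le_add)

lemma polys_le_mult: "a \<in> polys_le k \<Longrightarrow> b \<in> polys_le l \<Longrightarrow> a * b \<in> polys_le (k + l)"
  using keys_mult[of a b] unfolding polys_le_iff
  by (fastforce simp: mono_deg_add intro: add_mono)

lemma polys_le_power2: "a \<in> polys_le k \<Longrightarrow> a ^ 2 \<in> polys_le (2 * k)"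
  using polys_le_mult[of a k a k] by (simp add: power2_eq_square mult_2)

lemma polys_le_scale: "a \<in> polys_le k \<Longrightarrow> mconst c * a \<in> polys_le k"
  using polys_le_mult[of "mconst c" 0 a k] by simp

section \<open>Evaluation as a ring homomorphism\<close>

lemma peval_superset:
  assumes "finite A" "keys h \<subseteq> A"
  shows "peval h x = (\<Sum>\<alpha>\<in>A. lookup h \<alpha> * mono_val \<alpha> x)"
  unfolding peval_def mono_val_def[symmetric]
  using assms by (intro sum.mono_neutral_left) (auto simp: in_keys_iff)

lemma peval_0 [simp]: "peval 0 x = 0"
  by (simp add: peval_def)

lemma peval_single [simp]: "peval (single \<alpha> c) x = c * mono_val \<alpha> x"
  by (subst peval_superset[of "{\<alpha>}"]) auto

lemma peval_mconst [simp]: "peval (mconst c) x = c"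
  by (simp add: mconst_def)

lemma peval_numeral [simp]: "peval (numeral n) x = numeral n"
  using peval_mconst[of "numeral n" x] by (simp add: mconst_def)

lemma peval_mvar [simp]: "peval (mvar i) x = x $ i"
  by (simp add: mvar_def)

lemma peval_add [simp]: "peval (a + b) x = peval a x + peval b x"
proof -
  let ?A = "keys a \<union> keys b"
  have "peval (a + b) x = (\<Sum>\<alpha>\<in>?A. lookup (a + b) \<alpha> * mono_val \<alpha> x)"
    by (rule peval_superset) (use keys_add[of a b] in auto)
  moreover have "peval a x = (\<Sum>\<alpha>\<in>?A. lookup a \<alpha> * mono_val \<alpha> x)"
    by (rule peval_superset) auto
  moreover have "peval b x = (\<Sum>\<alpha>\<in>?A. lookup b \<alpha> * mono_val \<alpha> x)"
    by (rule peval_superset) auto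
  ultimately show ?thesis
    by (simp add: lookup_add distrib_right sum.distrib)
qed

lemma peval_sum [simp]: "peval (sum f A) x = (\<Sum>i\<in>A. peval (f i) x)"
  by (induction A rule: infinite_finite_induct) auto

lemma peval_mult [simp]: "peval (a * b) x = peval a x * peval b x"
proof -
  have "a * b = (\<Sum>\<alpha>\<in>keys a. single \<alpha> (lookup a \<alpha>)) * (\<Sum>\<beta>\<in>keys b. single \<beta> (lookup b \<beta>))"
    by (rule arg_cong2[where f = "(*)"]) (rule poly_mapping_sum_single; simp)+
  also have "\<dots> = (\<Sum>\<alpha>\<in>keys a. \<Sum>\<beta>\<in>keys b. single (\<alpha> + \<beta>) (lookup a \<alpha> * lookup b \<beta>))"
    by (simp add: sum_product mult_single)
  finally have "peval (a * b) x
      = (\<Sum>\<alpha>\<in>keys a. \<Sum>\<beta>\<in>keys b. (lookup a \<alpha> * mono_val \<alpha> x) * (lookup b \<beta> * mono_val \<beta> x))"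
    by (simp add: mono_val_add mult.commute mult.left_commute)
  also have "\<dots> = peval a x * peval b x"
    by (simp add: sum_product[symmetric] peval_superset[of "keys a" a] peval_superset[of "keys b" b])
  finally show ?thesis .
qed

lemma peval_1 [simp]: "peval 1 x = 1"
  using peval_mconst[of 1 x] by (simp add: mconst_def)

lemma peval_uminus [simp]: "peval (- a) x = - peval a x"
  using peval_add[of a "- a" x] by simp

lemma peval_diff [simp]: "peval (a - b) x = peval a x - peval b x"
  using peval_add[of a "- b" x] by simp

lemma peval_power [simp]: "peval (a ^ n) x = peval a x ^ n"
  by (induction n) auto

lemma mpoly_induct [case_names const var add mult]:
  fixes h :: "('v::finite, real) mpoly"
  assumes c: "\<And>c. P (mconst c)" and v: "\<And>i. P (mvar i)"
    and a: "\<And>a b. P a \<Longrightarrow> P b \<Longrightarrow> P (a + b)" and m: "\<And>a b. P a \<Longrightarrow> P b \<Longrightarrow> P (a * b)"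
  shows "P h"
proof -
  have s: "P (single \<alpha> r)" for \<alpha> r
  proof (induction \<alpha> rule: mono_induct)
    case zero
    then show ?case using c[of r] by (simp add: mconst_def)
  next
    case (add \<alpha> i)
    then show ?case using m[OF add v[of i]] by (simp add: mvar_def mult_single)
  qed
  have "P (\<Sum>\<alpha>\<in>A. single \<alpha> (lookup h \<alpha>))" if "finite A" for A
    using that
  proof induction
    case empty
    then show ?case using c[of 0] by (simp add: mconst_def)
  next
    case (insert \<alpha> A)
    then show ?case using a s by simp
  qed
  then show ?thesis
    by (subst poly_mapping_sum_single[of "keys h" h]) auto
qed

lemma continuous_on_peval [continuous_intros]: "continuous_on S (peval h)"
  by (induction h rule: mpoly_induct)
     (auto intro!: continuous_intros simp: peval_add[abs_def] peval_mult[abs_def])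

text \<open>Both bounds go through one induction, because in a product the size of one factor
  multiplies the Lipschitz constant of the other. A common constant keeps the invariant
  short.\<close>

lemma peval_bounded_lipschitz:
  assumes "bounded S"
  shows "\<exists>B\<ge>0. (\<forall>x\<in>S. \<bar>peval h x\<bar> \<le> B) \<and> (\<forall>x\<in>S. \<forall>y\<in>S. \<bar>peval h x - peval h y\<bar> \<le> B * norm (x - y))"
proof (induction h rule: mpoly_induct)
  case (const c)
  show ?case by (intro exI[of _ "\<bar>c\<bar>"]) auto
next
  case (var i)
  from assms obtain r where r: "\<And>x. x \<in> S \<Longrightarrow> norm x \<le> r" by (auto simp: bounded_iff)
  show ?case
  proof (intro exI[of _ "max 1 r"] conjI ballI)
    fix x assume "x \<in> S"
    then show "\<bar>peval (mvar i) x\<bar> \<le> max 1 r"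
      using component_le_norm_cart[of x i] r[of x] by simp
  next
    fix x y assume "x \<in> S" "y \<in> S"
    have "\<bar>x $ i - y $ i\<bar> \<le> 1 * norm (x - y)"
      using component_le_norm_cart[of "x - y" i] by simp
    also have "\<dots> \<le> max 1 r * norm (x - y)" by (intro mult_right_mono) auto
    finally show "\<bar>peval (mvar i) x - peval (mvar i) y\<bar> \<le> max 1 r * norm (x - y)" by simp
  qed simp
next
  case (add a b)
  then obtain A B where A: "A \<ge> 0" "\<forall>x\<in>S. \<bar>peval a x\<bar> \<le> A"
      "\<forall>x\<in>S. \<forall>y\<in>S. \<bar>peval a x - peval a y\<bar> \<le> A * norm (x - y)"
    and B: "B \<ge> 0" "\<forall>x\<in>S. \<bar>peval b x\<bar> \<le> B"
      "\<forall>x\<in>S. \<forall>y\<in>S. \<bar>peval b x - peval b y\<bar> \<le> B * norm (x - y)" by blast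
  show ?case
  proof (intro exI[of _ "A + B"] conjI ballI)
    fix x assume "x \<in> S" with A B show "\<bar>peval (a + b) x\<bar> \<le> A + B" by force
  next
    fix x y assume xy: "x \<in> S" "y \<in> S"
    have "\<bar>peval (a + b) x - peval (a + b) y\<bar> \<le> \<bar>peval a x - peval a y\<bar> + \<bar>peval b x - peval b y\<bar>"
      by simp
    also have "\<dots> \<le> A * norm (x - y) + B * norm (x - y)" using A B xy by (intro add_mono) auto
    finally show "\<bar>peval (a + b) x - peval (a + b) y\<bar> \<le> (A + B) * norm (x - y)"
      by (simp add: distrib_right)
  qed (use A B in simp)
next
  case (mult a b)
  then obtain A B where A: "A \<ge> 0" "\<forall>x\<in>S. \<bar>peval a x\<bar> \<le> A"
      "\<forall>x\<in>S. \<forall>y\<in>S. \<bar>peval a x - peval a y\<bar> \<le> A * norm (x - y)"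
    and B: "B \<ge> 0" "\<forall>x\<in>S. \<bar>peval b x\<bar> \<le> B"
      "\<forall>x\<in>S. \<forall>y\<in>S. \<bar>peval b x - peval b y\<bar> \<le> B * norm (x - y)" by blast
  show ?case
  proof (intro exI[of _ "2 * A * B"] conjI ballI)
    fix x assume "x \<in> S"
    with A B have "\<bar>peval a x\<bar> * \<bar>peval b x\<bar> \<le> A * B" by (intro mult_mono) auto
    also have "\<dots> \<le> 2 * A * B" using A B by simp
    finally show "\<bar>peval (a * b) x\<bar> \<le> 2 * A * B" by (simp add: abs_mult)
  next
    fix x y assume xy: "x \<in> S" "y \<in> S"
    have "peval (a * b) x - peval (a * b) y
        = peval a x * (peval b x - peval b y) + (peval a x - peval a y) * peval b y"
      by (simp add: algebra_simps)
    then have "\<bar>peval (a * b) x - peval (a * b) y\<bar>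
        \<le> \<bar>peval a x\<bar> * \<bar>peval b x - peval b y\<bar> + \<bar>peval a x - peval a y\<bar> * \<bar>peval b y\<bar>"
      by (metis abs_mult abs_triangle_ineq)
    also have "\<dots> \<le> A * (B * norm (x - y)) + (A * norm (x - y)) * B"
      using A B xy by (intro add_mono mult_mono) auto
    finally show "\<bar>peval (a * b) x - peval (a * b) y\<bar> \<le> 2 * A * B * norm (x - y)"
      by (simp add: algebra_simps)
  qed (use A B in simp)
qed

text \<open>Induction on the variables: grouping by the exponent of one variable gives a univariate
  polynomial that vanishes identically, so each group vanishes in the remaining variables. Exponents
  are separated by their values on V, since otherwise a monomial over V could occur twice.\<close>

lemma monomials_independent:
  fixes c :: "('v::finite \<Rightarrow> nat) \<Rightarrow> real"
  assumes "finite V" "finite A" "\<And>a b. a \<in> A \<Longrightarrow> b \<in> A \<Longrightarrow> (\<forall>i\<in>V. a i = b i) \<Longrightarrow> a = b"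
    and "\<And>x. (\<Sum>a\<in>A. c a * (\<Prod>i\<in>V. x i ^ a i)) = 0"
  shows "\<forall>a\<in>A. c a = 0"
  using assms
proof (induction V arbitrary: A rule: finite_induct)
  case empty
  show ?case
  proof
    fix a assume a: "a \<in> A"
    then have "A = {a}" using empty.prems(2) by auto
    with empty.prems(3)[of "\<lambda>_. 0"] show "c a = 0" by simp
  qed
next
  case (insert v V)
  define N where "N = Max (insert 0 ((\<lambda>a. a v) ` A))"
  have N: "a v \<le> N" if "a \<in> A" for a
    unfolding N_def using that insert.prems(1) by (intro Max_ge) auto
  define A' where "A' n = {a \<in> A. a v = n}" for n
  have zero: "(\<Sum>a\<in>A' n. c a * (\<Prod>i\<in>V. x i ^ a i)) = 0" if n: "n \<le> N" for x n
  proof -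
    define C where "C n = (\<Sum>a\<in>A' n. c a * (\<Prod>i\<in>V. x i ^ a i))" for n
    have "(\<Sum>n\<le>N. C n * t ^ n) = 0" for t
    proof -
      let ?x = "x(v := t)"
      have *: "(\<Prod>i\<in>V. ?x i ^ a i) = (\<Prod>i\<in>V. x i ^ a i)" for a :: "'v \<Rightarrow> nat"
        by (rule prod.cong) (use insert.hyps in auto)
      have "0 = (\<Sum>a\<in>A. c a * (\<Prod>i\<in>insert v V. ?x i ^ a i))"
        using insert.prems(3) by simp
      also have "\<dots> = (\<Sum>a\<in>A. c a * (\<Prod>i\<in>V. x i ^ a i) * t ^ a v)"
        using insert.hyps * by (simp add: mult.assoc mult.commute mult.left_commute)
      also have "\<dots> = (\<Sum>n\<le>N. \<Sum>a\<in>A' n. c a * (\<Prod>i\<in>V. x i ^ a i) * t ^ a v)"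
        unfolding A'_def
        by (rule sum.group[symmetric]) (use N insert.prems(1) in auto)
      also have "\<dots> = (\<Sum>n\<le>N. C n * t ^ n)"
        unfolding C_def sum_distrib_right by (intro sum.cong) (auto simp: A'_def)
      finally show ?thesis by simp
    qed
    then have "\<forall>n\<le>N. C n = 0" using polyfun_eq_0[of C N] by blast
    with n show ?thesis by (simp add: C_def)
  qed
  show ?case
  proof
    fix a assume a: "a \<in> A"
    have "\<forall>b\<in>A' (a v). c b = 0"
    proof (rule insert.IH)
      show "finite (A' (a v))" using insert.prems(1) by (simp add: A'_def)
      show "(\<Sum>b\<in>A' (a v). c b * (\<Prod>i\<in>V. x i ^ b i)) = 0" for x
        using zero N a by blast
      show "b = b'" if "b \<in> A' (a v)" "b' \<in> A' (a v)" "\<forall>i\<in>V. b i = b' i" for b b'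
        using that insert.prems(2)[of b b'] by (auto simp: A'_def)
    qed
    with a show "c a = 0" by (simp add: A'_def)
  qed
qed

text \<open>Functionals act on formal polynomials, whereas calculus yields identities between
  values; this is the way back.\<close>

lemma peval_inject:
  assumes "\<And>x. peval a x = peval b x"
  shows "a = b"
proof -
  define h where "h = a - b"
  define c where "c e = lookup h (Abs_poly_mapping e)" for e :: "'a \<Rightarrow> nat"
  have "\<forall>e\<in>lookup ` keys h. c e = 0"
  proof (rule monomials_independent[of UNIV])
    fix x :: "'a \<Rightarrow> real"
    have "(\<Sum>e\<in>lookup ` keys h. c e * (\<Prod>i\<in>UNIV. x i ^ e i))
        = (\<Sum>\<alpha>\<in>keys h. c (lookup \<alpha>) * (\<Prod>i\<in>UNIV. x i ^ lookup \<alpha> i))"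
      by (subst sum.reindex) (auto intro!: inj_onI poly_mapping_eqI)
    also have "\<dots> = peval h (\<chi> i. x i)"
      by (simp add: peval_def c_def lookup_inverse)
    also have "\<dots> = 0" using assms by (simp add: h_def)
    finally show "(\<Sum>e\<in>lookup ` keys h. c e * (\<Prod>i\<in>UNIV. x i ^ e i)) = 0" .
  qed auto
  then have "lookup h \<alpha> = 0" for \<alpha>
    by (cases "\<alpha> \<in> keys h") (auto simp: c_def lookup_inverse in_keys_iff)
  then have "h = 0" by (intro poly_mapping_eqI) simp
  then show ?thesis by (simp add: h_def)
qed

section \<open>Directional derivatives and restriction to lines\<close>

lemma mono_val_pderiv:
  "((\<lambda>t. mono_val \<alpha> (a + t *\<^sub>R v)) has_real_derivative
     (\<Sum>i\<in>UNIV. v $ i * (of_nat (lookup \<alpha> i) * mono_val (\<alpha> - single i 1) (a + s *\<^sub>R v)))) (at s)"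
proof -
  let ?x = "a + s *\<^sub>R v"
  have "((\<lambda>t. \<Prod>i\<in>UNIV. (a $ i + t * v $ i) ^ lookup \<alpha> i) has_real_derivative
      (\<Sum>i\<in>UNIV. (of_nat (lookup \<alpha> i) * (a $ i + s * v $ i) ^ (lookup \<alpha> i - 1) * v $ i) *
        (\<Prod>j\<in>UNIV-{i}. (a $ j + s * v $ j) ^ lookup \<alpha> j))) (at s)"
    by (rule has_field_derivative_prod) (auto intro!: derivative_eq_intros)
  moreover have "(of_nat (lookup \<alpha> i) * (a $ i + s * v $ i) ^ (lookup \<alpha> i - 1) * v $ i) *
        (\<Prod>j\<in>UNIV-{i}. (a $ j + s * v $ j) ^ lookup \<alpha> j)
      = v $ i * (of_nat (lookup \<alpha> i) * mono_val (\<alpha> - single i 1) ?x)" for i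
  proof -
    have "mono_val (\<alpha> - single i 1) ?x
        = (?x $ i) ^ (lookup \<alpha> i - 1) * (\<Prod>j\<in>UNIV-{i}. (?x $ j) ^ lookup (\<alpha> - single i 1) j)"
      unfolding mono_val_def by (subst prod.remove[of _ i]) (auto simp: lookup_minus)
    also have "(\<Prod>j\<in>UNIV-{i}. (?x $ j) ^ lookup (\<alpha> - single i 1) j)
        = (\<Prod>j\<in>UNIV-{i}. (?x $ j) ^ lookup \<alpha> j)"
      by (rule prod.cong) (auto simp: lookup_minus lookup_single when_def)
    finally show ?thesis by simp
  qed
  ultimately have "((\<lambda>t. \<Prod>i\<in>UNIV. (a $ i + t * v $ i) ^ lookup \<alpha> i) has_real_derivative
      (\<Sum>i\<in>UNIV. v $ i * (of_nat (lookup \<alpha> i) * mono_val (\<alpha> - single i 1) ?x))) (at s)"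
    by (simp only:)
  then show ?thesis
    by (simp add: mono_val_def[of \<alpha>])
qed

lemma peval_has_derivative_line:
  "((\<lambda>t. peval h (a + t *\<^sub>R v)) has_real_derivative
     (\<Sum>i\<in>UNIV. v $ i * peval (pderiv_at i h) (a + s *\<^sub>R v))) (at s)"
proof -
  have "((\<lambda>t. \<Sum>\<alpha>\<in>keys h. lookup h \<alpha> * mono_val \<alpha> (a + t *\<^sub>R v)) has_real_derivative
      (\<Sum>\<alpha>\<in>keys h. lookup h \<alpha> *
        (\<Sum>i\<in>UNIV. v $ i * (of_nat (lookup \<alpha> i) * mono_val (\<alpha> - single i 1) (a + s *\<^sub>R v))))) (at s)"
    by (intro derivative_intros DERIV_cmult mono_val_pderiv)
  moreover have "(\<Sum>\<alpha>\<in>keys h. lookup h \<alpha> *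
        (\<Sum>i\<in>UNIV. v $ i * (of_nat (lookup \<alpha> i) * mono_val (\<alpha> - single i 1) (a + s *\<^sub>R v))))
      = (\<Sum>i\<in>UNIV. v $ i * peval (pderiv_at i h) (a + s *\<^sub>R v))"
    unfolding pderiv_at_def peval_sum peval_single sum_distrib_left
    by (subst sum.swap) (intro sum.cong refl, simp add: algebra_simps)
  ultimately show ?thesis
    by (simp add: peval_superset[of "keys h" h])
qed

text \<open>The coefficients of the powers of s stay polynomials in z of degree at most k, so a
  truncated functional can be applied to each of them. The length N is free, which lets expansions
  of different lengths be added and multiplied.\<close>

lemma line_expansion_aux:
  assumes "h \<in> polys_le k"
  shows "\<exists>c N. (\<forall>i. c i \<in> polys_le k) \<and> (\<forall>i>N. c i = 0) \<and>
    (\<forall>s z. peval h (a + s *\<^sub>R (z - a)) = (\<Sum>i\<le>N. peval (c i) z * s ^ i))"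
    (is "?P k h")
proof -
  have add: "?P k (p + q)" if p: "?P k p" and q: "?P k q" for p q k
  proof -
    from p obtain c N where c: "\<forall>i. c i \<in> polys_le k" "\<forall>i>N. c i = 0"
      "\<forall>s z. peval p (a + s *\<^sub>R (z - a)) = (\<Sum>i\<le>N. peval (c i) z * s ^ i)" by (elim exE conjE)
    from q obtain c' N' where c': "\<forall>i. c' i \<in> polys_le k" "\<forall>i>N'. c' i = 0"
      "\<forall>s z. peval q (a + s *\<^sub>R (z - a)) = (\<Sum>i\<le>N'. peval (c' i) z * s ^ i)" by (elim exE conjE)
    have ext: "(\<Sum>i\<le>N. peval (c i) z * s ^ i) = (\<Sum>i\<le>max N N'. peval (c i) z * s ^ i)"
              "(\<Sum>i\<le>N'. peval (c' i) z * s ^ i) = (\<Sum>i\<le>max N N'. peval (c' i) z * s ^ i)" for s z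
      by (intro sum.mono_neutral_left; auto simp: c(2) c'(2))+
    show ?thesis
      by (intro exI[of _ "\<lambda>i. c i + c' i"] exI[of _ "max N N'"])
         (auto simp: c c' ext distrib_right sum.distrib intro: polys_le_add)
  qed
  have mult: "?P (k + l) (p * q)" if p: "?P k p" and q: "?P l q" for p q k l
  proof -
    from p obtain c N where c: "\<forall>i. c i \<in> polys_le k" "\<forall>i>N. c i = 0"
      "\<forall>s z. peval p (a + s *\<^sub>R (z - a)) = (\<Sum>i\<le>N. peval (c i) z * s ^ i)" by (elim exE conjE)
    from q obtain c' N' where c': "\<forall>i. c' i \<in> polys_le l" "\<forall>i>N'. c' i = 0"
      "\<forall>s z. peval q (a + s *\<^sub>R (z - a)) = (\<Sum>i\<le>N'. peval (c' i) z * s ^ i)" by (elim exE conjE)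
    have prod: "(\<Sum>i\<le>N. peval (c i) z * s ^ i) * (\<Sum>i\<le>N'. peval (c' i) z * s ^ i)
        = (\<Sum>r\<le>N + N'. (\<Sum>k\<le>r. peval (c k) z * peval (c' (r - k)) z) * s ^ r)" for s z
      by (rule polynomial_product) (simp_all add: c c')
    have zero: "(\<Sum>k\<le>r. c k * c' (r - k)) = 0" if "r > N + N'" for r
    proof (rule sum.neutral, rule ballI)
      fix k
      show "c k * c' (r - k) = 0"
        using that c(2) c'(2) by (cases "k > N") auto
    qed
    show ?thesis
      by (intro exI[of _ "\<lambda>r. \<Sum>k\<le>r. c k * c' (r - k)"] exI[of _ "N + N'"])
         (auto simp: c c' prod zero intro!: polys_le_sum polys_le_mult)
  qed
  have const: "?P 0 (mconst r)" for r
    by (intro exI[of _ "\<lambda>i. if i = 0 then mconst r else 0"] exI[of _ 0]) auto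
  have var: "?P 1 (mvar j)" for j
    by (intro exI[of _ "\<lambda>i. if i = 0 then mconst (a $ j) else if i = 1 then mvar j - mconst (a $ j) else 0"]
          exI[of _ 1])
       (auto simp: algebra_simps intro!: polys_le_diff polys_le_mvar)
  have mono_le: "?P l p" if "?P k p" "k \<le> l" for k l p
    using that polys_le_mono by meson
  \<comment> \<open>\<open>mpoly_induct\<close> would lose the degree bound, because its summands
    and factors may have larger degree than the result. A sum over the monomials of \<open>h\<close>
    keeps it.\<close>
  have mon: "?P (mono_deg \<alpha>) (single \<alpha> r)" for \<alpha> r
  proof (induction \<alpha> rule: mono_induct)
    case zero
    then show ?case using const[of r] by (simp add: mconst_def)
  next
    case (add \<alpha> i)
    then show ?case using mult[OF add var[of i]] by (simp add: mvar_def mult_single mono_deg_add)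
  qed
  have "?P k (\<Sum>\<alpha>\<in>A. single \<alpha> (lookup h \<alpha>))" if "finite A" "A \<subseteq> keys h" for A
    using that
  proof induction
    case empty
    then show ?case using mono_le[OF const[of 0]] by (simp add: mconst_def)
  next
    case (insert \<alpha> A)
    have "?P k (single \<alpha> (lookup h \<alpha>))"
      by (rule mono_le[OF mon]) (use insert.prems assms in \<open>auto simp: polys_le_iff\<close>)
    from add[OF this insert.IH] insert show ?case by simp
  qed
  from this[of "keys h"] show ?thesis
    by (simp flip: poly_mapping_sum_single)
qed

lemma line_expansion:
  assumes "h \<in> polys_le k"
  obtains c N where "\<And>i. c i \<in> polys_le k" "\<And>i. i > N \<Longrightarrow> c i = 0"
    "\<And>s z. peval h (a + s *\<^sub>R (z - a)) = (\<Sum>i\<le>N. peval (c i) z * s ^ i)"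
proof -
  from line_expansion_aux[OF assms, of a] obtain c N
    where "\<forall>i. c i \<in> polys_le k" "\<forall>i>N. c i = 0"
      "\<forall>s z. peval h (a + s *\<^sub>R (z - a)) = (\<Sum>i\<le>N. peval (c i) z * s ^ i)"
    by (elim exE conjE)
  then show thesis by (intro that[of c N]) auto
qed

text \<open>Meant for the entries of H, whose degrees are unknown; hence no degree bound on
  q.\<close>

lemma peval_line_poly: "\<exists>q. \<forall>z. peval q z = peval h (a + s *\<^sub>R (z - a))"
proof -
  have "h \<in> polys_le (mdeg h)" by (simp add: polys_le_def)
  then obtain c N where c: "\<And>i. c i \<in> polys_le (mdeg h)" "\<And>i. i > N \<Longrightarrow> c i = 0"
    "\<And>s z. peval h (a + s *\<^sub>R (z - a)) = (\<Sum>i\<le>N. peval (c i) z * s ^ i)"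
    by (rule line_expansion[where a = a]) blast
  then show ?thesis
    by (intro exI[of _ "\<Sum>i\<le>N. c i * mconst (s ^ i)"]) simp
qed

section \<open>Linear functionals and Jensen's inequality\<close>

locale truncated_functional =
  fixes k :: nat and L :: "('m::finite, real) mpoly \<Rightarrow> real"
  assumes linear: "linear_functional k L"
begin

lemma L_add: "a \<in> polys_le k \<Longrightarrow> b \<in> polys_le k \<Longrightarrow> L (a + b) = L a + L b"
  using linear by (simp add: linear_functional_def)

lemma L_scale: "a \<in> polys_le k \<Longrightarrow> L (mconst c * a) = c * L a"
  using linear by (simp add: linear_functional_def)

lemma L_0 [simp]: "L 0 = 0"
  using L_scale[of 0 0] by simp

lemma L_mconst: "L (mconst c) = c * L 1"
  using L_scale[of 1 c] by simp

lemma L_uminus: "a \<in> polys_le k \<Longrightarrow> L (- a) = - L a"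
  using L_add[of a "- a"] by (simp add: polys_le_uminus)

lemma L_diff: "a \<in> polys_le k \<Longrightarrow> b \<in> polys_le k \<Longrightarrow> L (a - b) = L a - L b"
  using L_add[of a "- b"] by (simp add: polys_le_uminus L_uminus)

lemma L_sum: "(\<And>i. i \<in> A \<Longrightarrow> f i \<in> polys_le k) \<Longrightarrow> L (sum f A) = (\<Sum>i\<in>A. L (f i))"
  by (induction A rule: infinite_finite_induct) (auto simp: L_add polys_le_sum)

lemma L_lincomb:
  "(\<And>i. i \<in> A \<Longrightarrow> f i \<in> polys_le k) \<Longrightarrow> L (\<Sum>i\<in>A. mconst (b i) * f i) = (\<Sum>i\<in>A. b i * L (f i))"
  by (subst L_sum) (auto simp: L_scale polys_le_scale)

lemma L_expand:
  assumes "h \<in> polys_le k"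
  shows "L h = (\<Sum>\<alpha>\<in>keys h. lookup h \<alpha> * L (single \<alpha> 1))"
proof -
  have s: "single \<alpha> (lookup h \<alpha>) = mconst (lookup h \<alpha>) * single \<alpha> 1" for \<alpha>
    by (simp add: mconst_def mult_single)
  have le: "single \<alpha> 1 \<in> polys_le k" if "\<alpha> \<in> keys h" for \<alpha>
    using assms that by (auto simp: polys_le_iff)
  have "L h = L (\<Sum>\<alpha>\<in>keys h. mconst (lookup h \<alpha>) * single \<alpha> 1)"
    by (rule arg_cong[of _ _ L]) (simp flip: s poly_mapping_sum_single)
  also have "\<dots> = (\<Sum>\<alpha>\<in>keys h. lookup h \<alpha> * L (single \<alpha> 1))"
    by (rule L_lincomb) (rule le)
  finally show ?thesis .
qed

end

lemma DERIV2_nonneg_ge_tangent: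
  fixes f f' f'' :: "real \<Rightarrow> real"
  assumes f: "\<And>s. (f has_real_derivative f' s) (at s)"
    and f': "\<And>s. (f' has_real_derivative f'' s) (at s)"
    and "\<And>s. f'' s \<ge> 0" and "f' 0 = 0"
  shows "f 0 \<le> f 1"
proof (rule DERIV_nonneg_imp_nondecreasing[of 0 1 f])
  fix x :: real assume "0 \<le> x"
  then have "f' 0 \<le> f' x"
    by (rule DERIV_nonneg_imp_nondecreasing) (use f' assms(3) in blast)
  with f \<open>f' 0 = 0\<close> show "\<exists>y. (f has_real_derivative y) (at x) \<and> 0 \<le> y" by auto
qed simp

text \<open>The derivative is kept linear in the coefficients b, so L can be applied term by term.
  The truncated exponent at i = 0 meets the coefficient 0.\<close>

lemma DERIV_polyfun:
  fixes b :: "nat \<Rightarrow> real"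
  shows "((\<lambda>t. \<Sum>i\<le>N. b i * t ^ i) has_real_derivative (\<Sum>i\<le>N. (real i * b i) * s ^ (i - 1))) (at s)"
  by (auto intro!: derivative_eq_intros sum.cong)

lemma DERIV_polyfun2:
  fixes b :: "nat \<Rightarrow> real"
  shows "((\<lambda>t. \<Sum>i\<le>N. (real i * b i) * t ^ (i - 1)) has_real_derivative
     (\<Sum>i\<le>N. (real i * real (i - 1) * b i) * s ^ (i - 2))) (at s)"
  by (auto intro!: derivative_eq_intros sum.cong simp: diff_diff_left numeral_2_eq_2)

text \<open>The second derivative is the Hessian form at v, and for a Hessian H^T H this is the
  squared norm of H v.\<close>

lemma sos_convex_line_second_derivative:
  assumes H: "\<And>i j. pderiv_at i (pderiv_at j h) = (\<Sum>l<r. H l i * H l j)"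
  shows "((\<lambda>t. \<Sum>j\<in>UNIV. v $ j * peval (pderiv_at j h) (a + t *\<^sub>R v)) has_real_derivative
    (\<Sum>l<(r::nat). (\<Sum>i\<in>UNIV. v $ i * peval (H l i) (a + s *\<^sub>R v))\<^sup>2)) (at s)"
proof -
  have "((\<lambda>t. \<Sum>j\<in>UNIV. v $ j * peval (pderiv_at j h) (a + t *\<^sub>R v)) has_real_derivative
     (\<Sum>j\<in>UNIV. v $ j * (\<Sum>i\<in>UNIV. v $ i * peval (pderiv_at i (pderiv_at j h)) (a + s *\<^sub>R v)))) (at s)"
    by (intro derivative_intros DERIV_cmult peval_has_derivative_line)
  moreover have "(\<Sum>j\<in>UNIV. v $ j * (\<Sum>i\<in>UNIV. v $ i * peval (pderiv_at i (pderiv_at j h)) x))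
      = (\<Sum>l<r. (\<Sum>i\<in>UNIV. v $ i * peval (H l i) x)\<^sup>2)" for x
  proof -
    have "(\<Sum>j\<in>UNIV. v $ j * (\<Sum>i\<in>UNIV. v $ i * peval (pderiv_at i (pderiv_at j h)) x))
        = (\<Sum>j\<in>UNIV. \<Sum>i\<in>UNIV. \<Sum>l<r. (v $ i * peval (H l i) x) * (v $ j * peval (H l j) x))"
      by (simp add: H sum_distrib_left algebra_simps)
    also have "\<dots> = (\<Sum>j\<in>UNIV. \<Sum>l<r. \<Sum>i\<in>UNIV. (v $ i * peval (H l i) x) * (v $ j * peval (H l j) x))"
      by (intro sum.cong refl sum.swap)
    also have "\<dots> = (\<Sum>l<r. \<Sum>j\<in>UNIV. \<Sum>i\<in>UNIV. (v $ i * peval (H l i) x) * (v $ j * peval (H l j) x))"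
      by (rule sum.swap)
    also have "\<dots> = (\<Sum>l<r. (\<Sum>i\<in>UNIV. v $ i * peval (H l i) x)\<^sup>2)"
      unfolding power2_eq_square sum_product by (intro sum.cong refl sum.swap)
    finally show ?thesis .
  qed
  ultimately show ?thesis by simp
qed

text \<open>With a = \<open>point_of L\<close> and L acting on z, put F(s) = L(h(a + s (z - a))).
  Then F'' is L of a sum of squares, F'(0) is L of a linear form in z - a and hence 0, so F(0) =
  h(a) is at most F(1) = L(h).\<close>

lemma jensen_sos_convex:
  assumes lin: "linear_functional (2 * d) L" and d: "1 \<le> d"
    and pos: "\<And>\<sigma>. \<sigma> \<in> sos_le d \<Longrightarrow> L \<sigma> \<ge> 0" and one: "L 1 = 1"
    and h: "h \<in> polys_le (2 * d)" "sos_convex h"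
  shows "peval h (point_of L) \<le> L h"
proof -
  interpret truncated_functional "2 * d" L by unfold_locales (rule lin)
  define a where "a = point_of L"
  obtain r H where H: "\<And>i j. pderiv_at i (pderiv_at j h) = (\<Sum>l<(r::nat). H l i * H l j)"
    using h(2) unfolding sos_convex_def by blast
  obtain c N where c: "\<And>i. c i \<in> polys_le (2 * d)" "\<And>i. i > N \<Longrightarrow> c i = 0"
    "\<And>s z. peval h (a + s *\<^sub>R (z - a)) = (\<Sum>i\<le>N. peval (c i) z * s ^ i)"
    by (rule line_expansion[OF h(1), where a = a]) blast
  have d1: "(\<Sum>j\<in>UNIV. (z - a) $ j * peval (pderiv_at j h) (a + s *\<^sub>R (z - a)))
      = (\<Sum>i\<le>N. (real i * peval (c i) z) * s ^ (i - 1))" for z s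
    by (rule DERIV_unique[OF _ DERIV_polyfun])
       (use peval_has_derivative_line[of h a "z - a" s] in \<open>simp add: c(3)\<close>)
  have d2: "(\<Sum>l<r. (\<Sum>i\<in>UNIV. (z - a) $ i * peval (H l i) (a + s *\<^sub>R (z - a)))\<^sup>2)
      = (\<Sum>i\<le>N. (real i * real (i - 1) * peval (c i) z) * s ^ (i - 2))" for z s
    using DERIV_unique[OF sos_convex_line_second_derivative[OF H, of "z - a" a s, unfolded d1]
        DERIV_polyfun2] .
  define F where "F s = (\<Sum>i\<le>N. L (c i) * s ^ i)" for s
  have nonneg: "(\<Sum>i\<le>N. (real i * real (i - 1) * L (c i)) * s ^ (i - 2)) \<ge> 0" for s
  proof -
    obtain G where G: "\<And>l i z. peval (G l i) z = peval (H l i) (a + s *\<^sub>R (z - a))"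
      using that[of "\<lambda>l i. SOME q. \<forall>z. peval q z = peval (H l i) (a + s *\<^sub>R (z - a))"]
        someI_ex[OF peval_line_poly[where a = a and s = s]] by blast
    define q where "q l = (\<Sum>i\<in>UNIV. (mvar i - mconst (a $ i)) * G l i)" for l
    define w where "w = (\<Sum>i\<le>N. mconst (real i * real (i - 1) * s ^ (i - 2)) * c i)"
    have "w = (\<Sum>l<r. q l ^ 2)"
    proof (rule peval_inject)
      fix z
      show "peval w z = peval (\<Sum>l<r. q l ^ 2) z"
        using d2[of z s] by (simp add: w_def q_def G mult.assoc mult.commute mult.left_commute)
    qed
    \<comment> \<open>The degree bound is read off from the coefficients of the expansion, not from
      the squares, whose summands come from H of unknown degree.\<close>
    moreover have "w \<in> polys_le (2 * d)"
      unfolding w_def by (intro polys_le_sum polys_le_scale c)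
    ultimately have "w \<in> sos_le d" by (auto simp: sos_le_def sos_def polys_le_def)
    then have "0 \<le> L w" by (rule pos)
    also have "L w = (\<Sum>i\<le>N. (real i * real (i - 1) * L (c i)) * s ^ (i - 2))"
      unfolding w_def by (subst L_lincomb) (rule c, simp add: ac_simps)
    finally show ?thesis .
  qed
  have "F 0 \<le> F 1"
  proof (rule DERIV2_nonneg_ge_tangent)
    show "(F has_real_derivative (\<Sum>i\<le>N. (real i * L (c i)) * s ^ (i - 1))) (at s)" for s
      unfolding F_def by (rule DERIV_polyfun)
    show "((\<lambda>s. \<Sum>i\<le>N. (real i * L (c i)) * s ^ (i - 1)) has_real_derivative
        (\<Sum>i\<le>N. (real i * real (i - 1) * L (c i)) * s ^ (i - 2))) (at s)" for s
      by (rule DERIV_polyfun2)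
    show "(\<Sum>i\<le>N. (real i * real (i - 1) * L (c i)) * s ^ (i - 2)) \<ge> 0" for s
      by (rule nonneg)
    \<comment> \<open>At s = 0 only the coefficient of s survives: the factor i removes i = 0 and
      the power of 0 removes i \<ge> 2. By \<open>d1\<close> this coefficient is the linear form
      \<open>t\<close>.\<close>
    define w where "w = (\<Sum>i\<le>N. mconst (real i * 0 ^ (i - 1)) * c i)"
    define t where "t = (\<Sum>j\<in>UNIV. mconst (peval (pderiv_at j h) a) * (mvar j - mconst (a $ j)))"
    have "w = t"
    proof (rule peval_inject)
      fix z
      show "peval w z = peval t z"
        using d1[of z 0] by (simp add: w_def t_def mult.assoc mult.commute mult.left_commute)
    qed
    moreover have "L w = (\<Sum>i\<le>N. (real i * L (c i)) * 0 ^ (i - 1))"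
      unfolding w_def by (subst L_lincomb) (rule c, simp add: ac_simps)
    moreover have "L t = 0"
    proof -
      have v: "mvar j \<in> polys_le (2 * d)" for j :: 'a
        using d by (intro polys_le_mvar) simp
      then have v': "mvar j - mconst (a $ j) \<in> polys_le (2 * d)" for j
        by (intro polys_le_diff) auto
      have "L (mvar j - mconst (a $ j)) = 0" for j
        by (simp add: L_diff v L_mconst one a_def point_of_def)
      then show ?thesis
        unfolding t_def by (subst L_lincomb) (auto simp: v')
    qed
    ultimately show "(\<Sum>i\<le>N. (real i * L (c i)) * 0 ^ (i - 1)) = 0" by simp
  qed
  moreover have "F 1 = L h"
  proof -
    have "(\<Sum>i\<le>N. c i) = h"
      using c(3)[of 1] by (intro peval_inject) simp
    then show ?thesis using L_sum[of "{..N}" c] by (simp add: F_def c)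
  qed
  moreover have "F 0 = peval h a"
  proof -
    have *: "(\<Sum>i\<le>N. f i * 0 ^ i) = f 0" for f :: "nat \<Rightarrow> real"
      by (subst sum.remove[of _ 0]) auto
    have "c 0 = mconst (peval h a)"
      using c(3)[of 0] by (intro peval_inject) (simp add: *)
    then show ?thesis by (simp add: F_def * L_mconst one)
  qed
  ultimately show ?thesis by (simp add: a_def)
qed

section \<open>Convexity of sos-convex polynomials\<close>

lemma linear_functional_combination:
  assumes "linear_functional k L" "linear_functional k L'"
  shows "linear_functional k (\<lambda>h. s * L h + t * L' h)"
  using assms by (simp add: linear_functional_def algebra_simps)

lemma linear_functional_peval: "linear_functional k (\<lambda>h. peval h x)"
  by (simp add: linear_functional_def)

lemma sos_peval_nonneg: "\<sigma> \<in> sos \<Longrightarrow> peval \<sigma> x \<ge> 0"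
  by (auto simp: sos_def intro!: sum_nonneg)

text \<open>Jensen's inequality for the functional that averages the values at x and z. The
  successor in \<open>d\<close> supplies both d \<ge> 1 and the degree bound.\<close>

lemma sos_convex_peval_le:
  assumes "sos_convex h" "0 \<le> t" "t \<le> 1"
  shows "peval h ((1 - t) *\<^sub>R x + t *\<^sub>R z) \<le> (1 - t) * peval h x + t * peval h z"
proof -
  define L where "L = (\<lambda>h. (1 - t) * peval h x + t * peval h z)"
  define d where "d = Suc (mdeg h)"
  have "peval h (point_of L) \<le> L h"
  proof (rule jensen_sos_convex)
    show "linear_functional (2 * d) L"
      unfolding L_def by (intro linear_functional_combination linear_functional_peval)
    show "L \<sigma> \<ge> 0" if "\<sigma> \<in> sos_le d" for \<sigma>
      using that assms(2,3) by (auto simp: L_def sos_le_def sos_peval_nonneg)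
    show "h \<in> polys_le (2 * d)" by (simp add: polys_le_def d_def)
  qed (use assms in \<open>auto simp: L_def d_def\<close>)
  moreover have "point_of L = (1 - t) *\<^sub>R x + t *\<^sub>R z"
    by (simp add: point_of_def L_def vec_eq_iff)
  ultimately show ?thesis by (simp add: L_def)
qed

section \<open>Moments of functionals concentrated on a ball\<close>

lemma power2_in_sos_le: "q \<in> polys_le d \<Longrightarrow> q ^ 2 \<in> sos_le d"
proof -
  assume "q \<in> polys_le d"
  then have "q ^ 2 \<in> polys_le (2 * d)" by (rule polys_le_power2)
  moreover have "q ^ 2 \<in> sos"
    unfolding sos_def by (intro CollectI exI[of _ "1::nat"] exI[of _ "\<lambda>_. q"]) simp
  ultimately show ?thesis by (simp add: sos_le_def polys_le_def)
qed

lemma sqnorm_poly_in_polys_le: "1 \<le> d \<Longrightarrow> sqnorm_poly \<in> polys_le (2 * d)"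
  unfolding sqnorm_poly_def by (intro polys_le_sum polys_le_power2 polys_le_mvar)

lemma power2_norm_cart: "(norm x)\<^sup>2 = (\<Sum>i\<in>UNIV. (x $ i)\<^sup>2)" for x :: "real ^ 'n::finite"
  by (simp only: power2_norm_eq_inner inner_vec_def) (simp add: power2_eq_square)

lemma peval_sqnorm_poly: "peval sqnorm_poly x = (norm x)\<^sup>2"
  by (simp add: sqnorm_poly_def power2_norm_cart)

text \<open>The value L 1 is left open: functionals of the dual relaxation have to be treated before
  normalization, when L 1 > 0 is still to be shown.\<close>

locale ball_functional = truncated_functional "2 * d" L
  for d :: nat and L :: "('m::finite, real) mpoly \<Rightarrow> real" +
  fixes R :: real
  assumes d_pos: "1 \<le> d"
    and sos_nonneg: "\<And>\<sigma>. \<sigma> \<in> sos_le d \<Longrightarrow> L \<sigma> \<ge> 0"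
    and ball_nonneg: "\<And>\<sigma>. \<sigma> \<in> sos_le (d - 1) \<Longrightarrow> L ((mconst (R\<^sup>2) - sqnorm_poly) * \<sigma>) \<ge> 0"
begin

lemma L_1_nonneg: "L 1 \<ge> 0"
  using sos_nonneg[OF power2_in_sos_le[of 1]] by simp

text \<open>Testing the ball constraint with the square of a monomial bounds the sum of the L(x_j^2
  x^(2\<beta>)) by R^2 L(x^(2\<beta>)). All summands are nonnegative, so each one obeys this
  bound.\<close>

lemma even_moment_bound:
  "mono_deg \<beta> \<le> d \<Longrightarrow> L (single (\<beta> + \<beta>) 1) \<le> (R\<^sup>2) ^ mono_deg \<beta> * L 1"
proof (induction \<beta> rule: mono_induct)
  case zero
  then show ?case by simp
next
  case (add \<beta> i)
  then have \<beta>: "mono_deg \<beta> \<le> d - 1" and \<beta>d: "mono_deg \<beta> \<le> d" by (auto simp: mono_deg_add)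
  define \<sigma> :: "('m, real) mpoly" where "\<sigma> = single \<beta> 1 ^ 2"
  have \<sigma>: "\<sigma> = single (\<beta> + \<beta>) 1" by (simp add: \<sigma>_def power2_eq_square mult_single)
  have \<sigma>_le: "\<sigma> \<in> polys_le (2 * d)"
    unfolding \<sigma>_def by (intro polys_le_power2 polys_le_single \<beta>d)
  have sq: "mvar j ^ 2 * \<sigma> = single (\<beta> + single j 1) 1 ^ 2" for j
    by (simp add: \<sigma>_def mvar_def power2_eq_square mult_single algebra_simps)
  have deg: "single (\<beta> + single j 1) (1::real) \<in> polys_le d" for j
    using \<beta> d_pos by (intro polys_le_single) (simp add: mono_deg_add)
  have sq_le: "mvar j ^ 2 * \<sigma> \<in> polys_le (2 * d)" for j
    unfolding sq by (intro polys_le_power2 deg)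
  have "0 \<le> L ((mconst (R\<^sup>2) - sqnorm_poly) * \<sigma>)"
    by (rule ball_nonneg) (unfold \<sigma>_def, intro power2_in_sos_le polys_le_single \<beta>)
  also have "(mconst (R\<^sup>2) - sqnorm_poly) * \<sigma> = mconst (R\<^sup>2) * \<sigma> - (\<Sum>j\<in>UNIV. mvar j ^ 2 * \<sigma>)"
    by (simp add: sqnorm_poly_def left_diff_distrib sum_distrib_right)
  also have "L \<dots> = R\<^sup>2 * L \<sigma> - (\<Sum>j\<in>UNIV. L (mvar j ^ 2 * \<sigma>))"
    by (simp add: L_diff L_scale L_sum \<sigma>_le sq_le polys_le_scale polys_le_sum)
  finally have "(\<Sum>j\<in>UNIV. L (mvar j ^ 2 * \<sigma>)) \<le> R\<^sup>2 * L \<sigma>" by simp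
  moreover have "L (mvar i ^ 2 * \<sigma>) \<le> (\<Sum>j\<in>UNIV. L (mvar j ^ 2 * \<sigma>))"
    by (rule member_le_sum) (auto simp: sq intro!: sos_nonneg power2_in_sos_le deg[simplified])
  moreover have "R\<^sup>2 * L \<sigma> \<le> R\<^sup>2 * ((R\<^sup>2) ^ mono_deg \<beta> * L 1)"
    using add.IH[OF \<beta>d] by (intro mult_left_mono) (auto simp: \<sigma>)
  moreover have "single (\<beta> + single i 1 + (\<beta> + single i 1)) 1 = mvar i ^ 2 * \<sigma>"
    unfolding sq by (simp add: power2_eq_square mult_single)
  ultimately show ?case by (simp add: mono_deg_add)
qed

text \<open>Positivity of L on the squares of x^\<beta> + x^\<gamma> and x^\<beta> - x^\<gamma>
  bounds a mixed moment by the two even ones. The maximum with 1 makes the bound uniform in the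
  degree.\<close>

lemma moment_bound:
  assumes "mono_deg \<alpha> \<le> 2 * d"
  shows "\<bar>L (single \<alpha> 1)\<bar> \<le> (max 1 (R\<^sup>2)) ^ d * L 1"
proof -
  define B where "B = (max 1 (R\<^sup>2)) ^ d"
  have even: "L (single (\<beta> + \<beta>) 1) \<le> B * L 1" if "mono_deg \<beta> \<le> d" for \<beta>
  proof -
    have "(R\<^sup>2) ^ mono_deg \<beta> \<le> (max 1 (R\<^sup>2)) ^ mono_deg \<beta>" by (intro power_mono) auto
    also have "\<dots> \<le> B" unfolding B_def by (intro power_increasing that) auto
    finally show ?thesis
      using even_moment_bound[OF that] mult_right_mono[OF _ L_1_nonneg] by fastforce
  qed
  obtain \<beta> \<gamma> where \<alpha>: "\<alpha> = \<beta> + \<gamma>" and deg: "mono_deg \<beta> \<le> d" "mono_deg \<gamma> \<le> d"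
    using mono_split_degree[of \<alpha> d d] assms by (auto simp: mult_2)
  have le: "single \<beta> 1 \<in> polys_le d" "single \<gamma> c \<in> polys_le d" for c :: real
    using deg by (auto intro: polys_le_single)
  have deg2: "mono_deg (\<beta> + \<beta>) \<le> 2 * d" "mono_deg (\<gamma> + \<gamma>) \<le> 2 * d" "mono_deg (\<beta> + \<gamma>) \<le> 2 * d"
    using deg by (auto simp: mono_deg_add)
  have sq: "0 \<le> L (single (\<beta> + \<beta>) 1) + L (single (\<gamma> + \<gamma>) 1) + c * (2 * L (single \<alpha> 1))"
    if "c\<^sup>2 = 1" for c
  proof -
    have "single \<beta> 1 + single \<gamma> c \<in> polys_le d" by (intro polys_le_add le)
    then have "0 \<le> L ((single \<beta> 1 + single \<gamma> c)\<^sup>2)" by (intro sos_nonneg power2_in_sos_le)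
    also have "(single \<beta> 1 + single \<gamma> c)\<^sup>2
        = single (\<beta> + \<beta>) 1 + single (\<gamma> + \<gamma>) 1 + mconst (2 * c) * single \<alpha> 1"
      using that by (intro peval_inject) (simp add: \<alpha> mono_val_add power2_eq_square algebra_simps)
    also have "L \<dots> = L (single (\<beta> + \<beta>) 1) + L (single (\<gamma> + \<gamma>) 1) + c * (2 * L (single \<alpha> 1))"
      by (simp add: L_add L_scale polys_le_add polys_le_scale polys_le_single deg2 \<alpha>)
    finally show ?thesis .
  qed
  show ?thesis
    using sq[of 1] sq[of "-1"] even[OF deg(1)] even[OF deg(2)] by (simp add: B_def)
qed

lemma L_eq_0:
  assumes "L 1 = 0" "h \<in> polys_le (2 * d)"
  shows "L h = 0"
proof -
  have "L (single \<alpha> 1) = 0" if "\<alpha> \<in> keys h" for \<alpha>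
    using moment_bound[of \<alpha>] that assms by (auto simp: polys_le_iff)
  then show ?thesis using L_expand[OF assms(2)] by simp
qed

text \<open>The variance L((x_i - u_i)^2) is nonnegative, so u_i^2 is at most L(x_i^2); summing over
  i reaches the ball constraint.\<close>

lemma norm_point_of_le:
  assumes "L 1 = 1" "R \<ge> 0"
  shows "norm (point_of L) \<le> R"
proof -
  let ?u = "point_of L"
  have v: "mvar i \<in> polys_le d" "mvar i \<in> polys_le (2 * d)" for i :: 'm
    using d_pos by (auto intro: polys_le_mvar)
  have "(?u $ i)\<^sup>2 \<le> L (mvar i ^ 2)" for i
  proof -
    have "0 \<le> L ((mvar i - mconst (?u $ i))\<^sup>2)"
      by (intro sos_nonneg power2_in_sos_le polys_le_diff v) simp
    also have "(mvar i - mconst (?u $ i))\<^sup>2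
        = mvar i ^ 2 - mconst (2 * ?u $ i) * mvar i + mconst ((?u $ i)\<^sup>2)"
      by (rule peval_inject) (simp add: power2_eq_square algebra_simps)
    also have "L \<dots> = L (mvar i ^ 2) - (2 * ?u $ i) * L (mvar i) + (?u $ i)\<^sup>2"
      by (simp add: L_add L_diff L_scale L_mconst assms v polys_le_scale polys_le_diff polys_le_power2)
    finally show ?thesis by (simp add: point_of_def power2_eq_square)
  qed
  then have "(\<Sum>i\<in>UNIV. (?u $ i)\<^sup>2) \<le> (\<Sum>i\<in>UNIV. L (mvar i ^ 2))" by (intro sum_mono)
  also have "\<dots> = L sqnorm_poly"
    unfolding sqnorm_poly_def by (subst L_sum) (auto intro: polys_le_power2 v)
  also have "\<dots> \<le> R\<^sup>2"
  proof -
    have "0 \<le> L ((mconst (R\<^sup>2) - sqnorm_poly) * 1 ^ 2)"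
      by (rule ball_nonneg[OF power2_in_sos_le]) simp
    then show ?thesis
      using L_diff[OF polys_le_mconst sqnorm_poly_in_polys_le[OF d_pos], of "R\<^sup>2"]
      by (simp add: L_mconst assms)
  qed
  finally have "(norm ?u)\<^sup>2 \<le> R\<^sup>2"
    by (simp add: power2_norm_cart)
  then show ?thesis using assms(2) by (rule power2_le_imp_le)
qed

end

section \<open>Chebyshev polynomials\<close>

text \<open>Defined over an arbitrary commutative ring, because it is applied both to a polynomial,
  as the test function, and to its real values; \<open>peval_cheb\<close> connects the two.\<close>

fun cheb :: "nat \<Rightarrow> 'a::comm_ring_1 \<Rightarrow> 'a" where
  "cheb 0 z = 1"
| "cheb (Suc 0) z = z"
| "cheb (Suc (Suc n)) z = z * cheb (Suc n) z + z * cheb (Suc n) z - cheb n z"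

lemma peval_cheb: "peval (cheb n q) x = cheb n (peval q x)"
  by (induction n q rule: cheb.induct) auto

lemma cheb_in_polys_le: "q \<in> polys_le m \<Longrightarrow> cheb n q \<in> polys_le (n * m)"
proof (induction n q rule: cheb.induct)
  case (3 n z)
  have "cheb (Suc n) z \<in> polys_le (Suc n * m)" "cheb n z \<in> polys_le (n * m)"
    using 3 by blast+
  then have "z * cheb (Suc n) z \<in> polys_le (m + Suc n * m)" "cheb n z \<in> polys_le (m + Suc n * m)"
    using 3 by (auto intro: polys_le_mult elim: polys_le_mono)
  moreover have "Suc (Suc n) * m = m + Suc n * m" by simp
  ultimately show ?case by (metis cheb.simps(3) polys_le_add polys_le_diff)
qed auto

lemma cheb_cos: "cheb n (cos t) = cos (real n * t)" for t :: real
proof (induction n "cos t" rule: cheb.induct)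
  case (3 n)
  have "cos (real (Suc (Suc n)) * t) = cos (real (Suc n) * t + t)" by (simp add: algebra_simps)
  moreover have "cos (real n * t) = cos (real (Suc n) * t - t)" by (simp add: algebra_simps)
  ultimately show ?case using 3 by (simp add: cos_add cos_diff)
qed auto

lemma abs_cheb_le_1:
  fixes z :: real
  assumes "\<bar>z\<bar> \<le> 1"
  shows "\<bar>cheb n z\<bar> \<le> 1"
  using cheb_cos[of n "arccos z"] assms by (simp add: cos_arccos_abs abs_le_iff)

text \<open>With r = sqrt (z^2 - 1) twice the Chebyshev polynomial is (z + r)^n + (z - r)^n. A
  distance h / 2 beyond 1 already makes r at least sqrt h, and this square root is the source of the
  squared rate.\<close>

lemma cheb_ge:
  fixes z h :: real
  assumes "0 \<le> h" "1 + h / 2 \<le> z"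
  shows "(1 + sqrt h) ^ n / 2 \<le> cheb n z"
proof -
  define r where "r = sqrt (z\<^sup>2 - 1)"
  have "(1 + h / 2)\<^sup>2 \<le> z\<^sup>2" using assms by (intro power_mono) auto
  moreover have "(1 + h / 2)\<^sup>2 = 1 + h + (h / 2)\<^sup>2" by (simp add: power2_eq_square algebra_simps)
  ultimately have zh: "h \<le> z\<^sup>2 - 1"
    using zero_le_power2[of "h / 2"] by linarith
  then have r: "r\<^sup>2 = z\<^sup>2 - 1" "sqrt h \<le> r" "0 \<le> r" using assms by (auto simp: r_def)
  have zr: "r \<le> z" by (rule power2_le_imp_le) (use assms r in linarith)+
  have "2 * cheb n z = (z + r) ^ n + (z - r) ^ n"
  proof (induction n rule: induct_nat_012)
    case (ge2 n)
    \<comment> \<open>Both z + r and z - r solve w^2 = 2 z w - 1, the characteristic equation of the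
      recurrence.\<close>
    have w: "(z + r)\<^sup>2 = 2 * z * (z + r) - 1" "(z - r)\<^sup>2 = 2 * z * (z - r) - 1"
      using r(1) by algebra+
    have "(z + r) ^ Suc (Suc n) + (z - r) ^ Suc (Suc n)
        = (z + r) ^ n * (z + r)\<^sup>2 + (z - r) ^ n * (z - r)\<^sup>2"
      by (simp add: power2_eq_square)
    also have "\<dots> = 2 * z * ((z + r) ^ Suc n + (z - r) ^ Suc n) - ((z + r) ^ n + (z - r) ^ n)"
      unfolding w by (simp add: algebra_simps)
    also have "\<dots> = 2 * cheb (Suc (Suc n)) z"
      unfolding ge2[symmetric] by (simp add: algebra_simps)
    finally show ?case by simp
  qed auto
  moreover have "(z - r) ^ n \<ge> 0" using zr by simp
  moreover have "(1 + sqrt h) ^ n \<le> (z + r) ^ n"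
    using assms r by (intro power_mono) auto
  ultimately show ?thesis by simp
qed

section \<open>Lower bounds for polynomials in the relaxed cone\<close>

lemma set_integrable_peval:
  "compact Y \<Longrightarrow> set_integrable lborel Y (peval h)"
  unfolding set_integrable_def by (intro borel_integrable_compact continuous_on_peval)

lemma integrable_indicator_compact:
  "compact S \<Longrightarrow> integrable lborel (indicator S :: 'a::euclidean_space \<Rightarrow> real)"
  using borel_integrable_compact[of S "\<lambda>_. 1::real"] by simp

text \<open>The test square is a Chebyshev polynomial of \<open>\<psi>\<close> itself: it is at most 1 where \<open>\<psi>\<close> exceeds
  its minimum by \<open>W h\<close>, and of size \<open>(1 + sqrt h) ^ (2 j)\<close> near the minimizer.\<close>

lemma Pk_needle:
  fixes \<psi> :: "('n::finite, real) mpoly"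
  assumes Y: "compact Y" "y0 \<in> Y" and min: "\<And>y. y \<in> Y \<Longrightarrow> peval \<psi> y0 \<le> peval \<psi> y"
    and \<psi>: "\<psi> \<in> Pk D Y k" and j: "j * D \<le> k" and h: "0 < h" "h \<le> 1" and W: "W > 0" and M: "M > 0"
    and bound: "\<And>y. y \<in> Y \<Longrightarrow> 2 * \<bar>peval \<psi> y\<bar> \<le> W"
    and lip: "\<And>y. y \<in> Y \<Longrightarrow> \<bar>peval \<psi> y - peval \<psi> y0\<bar> \<le> M * norm (y - y0)"
    and neg: "peval \<psi> y0 < - (2 * W * h)"
  shows "h * (1 + sqrt h) ^ (2 * j) / 4 * measure lborel (cball y0 (W * h / (2 * M)) \<inter> Y)
      \<le> measure lborel Y"
proof -
  \<comment> \<open>The radius satisfies M \<delta> = W h / 2, so on \<open>N\<close> the polynomial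
    exceeds its minimum by at most W h / 2.\<close>
  define \<delta> where "\<delta> = W * h / (2 * M)"
  define N where "N = cball y0 \<delta> \<inter> Y"
  define c where "c = W * h * (1 + sqrt h) ^ (2 * j) / 4"
  \<comment> \<open>An affine image of \<psi>: the minimum goes to 1 + h and the level W h above it
    to 1. Since \<psi> varies by at most W on Y, values of q stay nonnegative there.\<close>
  define q where "q = mconst (1 + h + peval \<psi> y0 / W) + mconst (- 1 / W) * \<psi>"
  define \<sigma> where "\<sigma> = (cheb j q)\<^sup>2"
  have Wh: "0 < W * h" using W h by simp
  have neg: "peval \<psi> y0 < - (2 * (W * h))" using neg by (simp only: mult.assoc)
  have \<psi>_le: "\<psi> \<in> polys_le D" using \<psi> by (simp add: Pk_def)
  then have "q \<in> polys_le D"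
    unfolding q_def by (intro polys_le_add polys_le_scale) auto
  then have "cheb j q \<in> polys_le k"
    using polys_le_mono[OF cheb_in_polys_le j] by blast
  then have "\<sigma> \<in> sos_le k" unfolding \<sigma>_def by (rule power2_in_sos_le)
  then have "0 \<le> (LINT y:Y|lborel. peval \<psi> y * peval \<sigma> y)"
    using \<psi> by (simp add: Pk_def)
  \<comment> \<open>The pointwise majorant: the integrand is at most W on Y and at most - c on
    \<open>N\<close>, where \<psi> \<le> - W h and \<sigma> \<ge> (1 + sqrt h) ^ (2 j) / 4.\<close>
  also have "\<dots> \<le> (LINT y|lborel. W * indicator Y y - c * indicator N y)"
    unfolding set_lebesgue_integral_def
  proof (rule integral_mono)
    have "set_integrable lborel Y (peval (\<psi> * \<sigma>))"
      by (rule set_integrable_peval[OF Y(1)])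
    then show "integrable lborel (\<lambda>y. indicator Y y *\<^sub>R (peval \<psi> y * peval \<sigma> y))"
      by (simp add: set_integrable_def)
    have cN: "compact N" unfolding N_def using Y(1) by (intro compact_Int) auto
    have "integrable lborel (indicator Y :: _ \<Rightarrow> real)" "integrable lborel (indicator N :: _ \<Rightarrow> real)"
      using Y(1) cN integrable_indicator_compact by blast+
    then show "integrable lborel (\<lambda>y. W * indicator Y y - c * indicator N y)"
      by (intro Bochner_Integration.integrable_diff integrable_mult_right) auto
  next
    fix y
    show "indicator Y y *\<^sub>R (peval \<psi> y * peval \<sigma> y) \<le> W * indicator Y y - c * indicator N y"
    proof (cases "y \<in> Y")
      case False
      then show ?thesis by (simp add: N_def)
    next
      case True
      define z where "z = 1 + h - (peval \<psi> y - peval \<psi> y0) / W"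
      have \<sigma>z: "peval \<sigma> y = (cheb j z)\<^sup>2"
      proof -
        have "peval q y = z" by (simp add: q_def z_def diff_divide_distrib)
        then show ?thesis by (simp add: \<sigma>_def peval_cheb)
      qed
      have "peval \<psi> y - peval \<psi> y0 \<le> W" using bound[OF True] bound[OF Y(2)] by linarith
      then have "(peval \<psi> y - peval \<psi> y0) / W \<le> 1" using W by simp
      then have z0: "0 \<le> z" using h by (simp add: z_def)
      show ?thesis
      proof (cases "y \<in> N")
        case N: True
        then have "norm (y - y0) \<le> \<delta>" by (simp add: N_def dist_norm norm_minus_commute)
        then have "M * norm (y - y0) \<le> M * \<delta>" using M by simp
        also have "M * \<delta> = W * h / 2" using M by (simp add: \<delta>_def)
        finally have d: "peval \<psi> y - peval \<psi> y0 \<le> W * h / 2" using lip[OF True] by linarith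
        then have "1 + h / 2 \<le> z" using W by (simp add: z_def field_simps)
        then have ch: "(1 + sqrt h) ^ j / 2 \<le> cheb j z" using h by (intro cheb_ge) auto
        have "((1 + sqrt h) ^ j / 2)\<^sup>2 \<le> (cheb j z)\<^sup>2"
          using ch h by (intro power_mono) auto
        then have s: "(1 + sqrt h) ^ (2 * j) / 4 \<le> peval \<sigma> y"
          by (simp add: \<sigma>z power_divide power_mult power2_eq_square mult_2 power_add)
        have "peval \<psi> y \<le> - (W * h)" using d neg Wh by linarith
        then have "peval \<psi> y * peval \<sigma> y \<le> - (W * h) * peval \<sigma> y"
          by (intro mult_right_mono) (auto simp: \<sigma>z)
        also have "\<dots> \<le> - c"
          using mult_left_mono[OF s, of "W * h"] W h by (simp add: c_def)
        finally show ?thesis using True N W by simp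
      next
        case N: False
        \<comment> \<open>Only \<psi> \<ge> 0 matters for an upper bound. There \<psi> is more than
          W h above its minimum, so the Chebyshev argument is in [0, 1] and the square at most
          1.\<close>
        have "peval \<psi> y * peval \<sigma> y \<le> W"
        proof (cases "peval \<psi> y < 0")
          case neg: True
          then have "peval \<psi> y * peval \<sigma> y \<le> 0" by (intro mult_nonpos_nonneg) (auto simp: \<sigma>z)
          then show ?thesis using W by linarith
        next
          case False
          then have "W * h \<le> peval \<psi> y - peval \<psi> y0" using neg Wh by linarith
          then have "z \<le> 1" using W by (simp add: z_def field_simps)
          with z0 have "\<bar>cheb j z\<bar> \<le> 1" by (intro abs_cheb_le_1) auto
          then have "peval \<sigma> y \<le> 1" unfolding \<sigma>z by (simp add: abs_square_le_1)
          then have "peval \<psi> y * peval \<sigma> y \<le> peval \<psi> y * 1"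
            using False by (intro mult_left_mono) auto
          then show ?thesis using bound[OF True] by linarith
        qed
        then show ?thesis using True N by simp
      qed
    qed
  qed
  also have "\<dots> = W * measure lborel Y - c * measure lborel N"
  proof -
    have cN: "compact N" unfolding N_def using Y(1) by (intro compact_Int) auto
    have "integrable lborel (indicator Y :: _ \<Rightarrow> real)" "integrable lborel (indicator N :: _ \<Rightarrow> real)"
      using Y(1) cN integrable_indicator_compact by blast+
    then show ?thesis by (subst Bochner_Integration.integral_diff) auto
  qed
  finally have "W * (h * (1 + sqrt h) ^ (2 * j) / 4 * measure lborel N) \<le> W * measure lborel Y"
    by (simp add: c_def mult.assoc)
  then show ?thesis using W by (simp add: N_def \<delta>_def)
qed

lemma exp_half_le: "0 \<le> x \<Longrightarrow> x \<le> 1 \<Longrightarrow> exp (x / 2) \<le> 1 + x" for x :: real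
proof -
  assume x: "0 \<le> x" "x \<le> 1"
  then have "exp (x / 2) \<le> 1 + x / 2 + (x / 2)\<^sup>2" by (intro exp_bound) auto
  also have "(x / 2)\<^sup>2 \<le> x / 2"
    using x mult_left_mono[of x 1 x] by (simp add: power2_eq_square)
  finally show ?thesis by simp
qed

text \<open>With t = sqrt h = A ln k / k the growth (1 + t) ^ (2 j) is at least k ^ (2 n + 3). The
  prefactor h and the ball volume contribute h ^ (n + 1), at least k ^ (- (2 n + 2)) since t \<ge> 1
  / k. The left side of \<open>Pk_needle\<close> is thus at least c0 k, which eventually exceeds the
  volume of Y.\<close>

lemma Pk_lower_bound:
  fixes Y :: "(real ^ 'n::finite) set"
  assumes Y: "compact Y" and W: "W > 0" and M: "M > 0"
    and A5: "\<epsilon> > 0" "\<eta> > 0" "\<And>y \<delta>. y \<in> Y \<Longrightarrow> 0 < \<delta> \<Longrightarrow> \<delta> < \<epsilon> \<Longrightarrow>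
      measure lborel (cball y \<delta> \<inter> Y) \<ge> \<eta> * measure lborel (cball y \<delta>)"
  shows "\<exists>C\<ge>0. \<exists>k0. \<forall>k\<ge>k0. \<forall>\<psi>\<in>Pk D Y k.
     (\<forall>y\<in>Y. 2 * \<bar>peval \<psi> y\<bar> \<le> W) \<longrightarrow>
     (\<forall>y\<in>Y. \<forall>y'\<in>Y. \<bar>peval \<psi> y - peval \<psi> y'\<bar> \<le> M * norm (y - y')) \<longrightarrow>
     (\<forall>y\<in>Y. peval \<psi> y \<ge> - (C * (ln (real k) / real k)\<^sup>2))"
proof -
  define n where "n = CARD('n)"
  \<comment> \<open>Chosen so that t k / (2 (D + 1)) = (2 n + 3) ln k, where k / (2 (D + 1)) is the
    lower bound for the Chebyshev degree j.\<close>
  define A where "A = real (2 * Suc D * (2 * n + 3))"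
  define h where "h k = (A * (ln (real k) / real k))\<^sup>2" for k
  define c0 where "c0 = \<eta> * unit_ball_vol n * (W / (2 * M)) ^ n / 4"
  have c0: "c0 > 0" using A5 W M by (simp add: c0_def)
  have A1: "A \<ge> 1" by (simp add: A_def)
  have lim: "(\<lambda>k. A * (ln (real k) / real k)) \<longlonglongrightarrow> A * 0"
    by (intro tendsto_intros lim_ln_over_n)
  then have lim2: "h \<longlonglongrightarrow> (A * 0)\<^sup>2"
    unfolding h_def[abs_def] by (intro tendsto_intros)
  have "eventually (\<lambda>k. A * (ln (real k) / real k) < 1) sequentially"
    using order_tendstoD(2)[OF lim, of 1] by simp
  moreover have "eventually (\<lambda>k. h k < 2 * M * \<epsilon> / W) sequentially"
    using order_tendstoD(2)[OF lim2, of "2 * M * \<epsilon> / W"] W M A5 by simp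
  moreover have "eventually (\<lambda>k. real k > measure lborel Y / c0) sequentially"
    using filterlim_real_sequentially by (auto simp: filterlim_at_top_dense)
  \<comment> \<open>In this order the conditions give t \<le> 1, \<delta> < \<epsilon>, the final
    contradiction, ln k \<ge> 1, and a loss of at most one half when k / (D + 1) is rounded
    down.\<close>
  ultimately have "eventually (\<lambda>k. A * (ln (real k) / real k) < 1 \<and> h k < 2 * M * \<epsilon> / W \<and>
      real k > measure lborel Y / c0 \<and> k \<ge> 3 \<and> k \<ge> 2 * Suc D) sequentially"
    by (intro eventually_conj eventually_ge_at_top)
  then obtain k0 where k0: "\<And>k. k \<ge> k0 \<Longrightarrow> A * (ln (real k) / real k) < 1 \<and> h k < 2 * M * \<epsilon> / W \<and>
      real k > measure lborel Y / c0 \<and> k \<ge> 3 \<and> k \<ge> 2 * Suc D"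
    unfolding eventually_sequentially by blast
  show ?thesis
  proof (intro exI[of _ "2 * W * A\<^sup>2"] exI[of _ k0] conjI allI impI ballI)
    show "0 \<le> 2 * W * A\<^sup>2" using W by simp
  next
    fix k \<psi> y
    assume k: "k0 \<le> k" and \<psi>: "\<psi> \<in> Pk D Y k" and b: "\<forall>y\<in>Y. 2 * \<bar>peval \<psi> y\<bar> \<le> W"
      and lip: "\<forall>y\<in>Y. \<forall>y'\<in>Y. \<bar>peval \<psi> y - peval \<psi> y'\<bar> \<le> M * norm (y - y')" and y: "y \<in> Y"
    note k' = k0[OF k]
    have kp: "real k > 0" "1 \<le> ln (real k)"
    proof -
      have "exp 1 \<le> real k" using k' exp_le by linarith
      then show "1 \<le> ln (real k)" using k' by (subst ln_ge_iff) auto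
    qed (use k' in auto)
    define t where "t = A * (ln (real k) / real k)"
    have t: "0 < t" "t \<le> 1" using k' kp A1 by (auto simp: t_def)
    have hk_t: "h k = t\<^sup>2" by (simp add: h_def t_def)
    have sqrt_h: "sqrt (h k) = t" using t by (simp add: hk_t)
    have h: "0 < h k" "h k \<le> 1" using t by (auto simp: hk_t power_le_one)
    have t_ge: "1 / real k \<le> t"
    proof -
      have "1 * 1 \<le> A * ln (real k)" using A1 kp by (intro mult_mono) auto
      then show ?thesis using kp by (simp add: t_def divide_right_mono)
    qed
    obtain y0 where y0: "y0 \<in> Y" "\<And>y. y \<in> Y \<Longrightarrow> peval \<psi> y0 \<le> peval \<psi> y"
      using continuous_attains_inf[OF Y _ continuous_on_peval] y by blast
    have "peval \<psi> y0 \<ge> - (2 * W * h k)"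
    proof (rule ccontr)
      assume "\<not> ?thesis"
      then have neg: "peval \<psi> y0 < - (2 * W * h k)" by simp
      \<comment> \<open>Dividing by the successor of D keeps j growing with k also for D =
        0.\<close>
      define j where "j = k div Suc D"
      define \<delta> where "\<delta> = W * h k / (2 * M)"
      have jD: "j * D \<le> k"
        using div_times_less_eq_dividend[of k "Suc D"] by (simp add: j_def)
      have needle: "h k * (1 + t) ^ (2 * j) / 4 * measure lborel (cball y0 \<delta> \<inter> Y) \<le> measure lborel Y"
        using Pk_needle[OF Y y0 \<psi> jD h W M _ _ neg] b lip y0(1) by (simp add: sqrt_h \<delta>_def)
      have \<delta>: "0 < \<delta>" "\<delta> < \<epsilon>"
        using h W M k' by (auto simp: \<delta>_def field_simps)
      have vol: "measure lborel (cball y0 \<delta> \<inter> Y) \<ge> \<eta> * (unit_ball_vol n * \<delta> ^ n)"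
        using A5(3)[OF y0(1) \<delta>] \<delta> by (simp add: content_cball n_def)
      have j_ge: "real k / (2 * Suc D) \<le> real j"
      proof -
        have "k < Suc D * Suc j"
          unfolding j_def using dividend_less_div_times[of "Suc D" k] by (simp add: algebra_simps)
        then have "real k < real (Suc D * Suc j)" by (simp only: of_nat_less_iff)
        moreover have "real k \<ge> 2 * real (Suc D)" using k' by (metis of_nat_le_iff of_nat_mult of_nat_numeral)
        ultimately show ?thesis by (simp add: field_simps)
      qed
      have "real k ^ (2 * n + 3) = exp (real (2 * n + 3) * ln (real k))"
        using kp by (metis exp_of_nat_mult exp_ln)
      also have "real (2 * n + 3) * ln (real k) = real k / (2 * Suc D) * t"
      proof -
        have *: "E * l = x / G * (G * E * (l / x))" if "G \<noteq> 0" "x \<noteq> 0" for E l x G :: real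
          using that by simp
        show ?thesis
          unfolding t_def A_def of_nat_mult[of "2 * Suc D"] by (rule *) (use kp in auto)
      qed
      also have "exp \<dots> \<le> exp (real j * t)"
        using mult_right_mono[OF j_ge, of t] t by simp
      also have "\<dots> = exp (t / 2) ^ (2 * j)"
        by (simp flip: exp_of_nat_mult)
      also have "\<dots> \<le> (1 + t) ^ (2 * j)"
        using exp_half_le[of t] t by (intro power_mono) auto
      finally have grow: "real k ^ (2 * n + 3) \<le> (1 + t) ^ (2 * j)" .
      have "(1 / real k) ^ (2 * n + 2) \<le> t ^ (2 * n + 2)"
        using t_ge kp by (intro power_mono) auto
      also have "t ^ (2 * n + 2) = h k ^ Suc n"
        by (simp only: hk_t power_mult[symmetric]) simp
      finally have hk: "(1 / real k) ^ (2 * n + 2) \<le> h k ^ Suc n" .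
      have "c0 * real k = c0 * ((1 / real k) ^ (2 * n + 2) * real k ^ (2 * n + 3))"
      proof -
        have "real k ^ (2 * n + 3) = real k ^ (2 * n + 2) * real k"
          by (simp add: power_Suc2[symmetric] numeral_3_eq_3)
        then show ?thesis using kp by (simp add: power_divide)
      qed
      also have "\<dots> \<le> c0 * (h k ^ Suc n * (1 + t) ^ (2 * j))"
        using c0 hk grow h kp by (intro mult_left_mono mult_mono) auto
      also have "\<dots> = h k * (1 + t) ^ (2 * j) / 4 * (\<eta> * (unit_ball_vol n * \<delta> ^ n))"
        by (simp add: c0_def \<delta>_def power_mult_distrib power_divide field_simps)
      also have "\<dots> \<le> h k * (1 + t) ^ (2 * j) / 4 * measure lborel (cball y0 \<delta> \<inter> Y)"
        using vol h t by (intro mult_left_mono) auto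
      also have "\<dots> \<le> measure lborel Y" by (rule needle)
      finally show False using k' c0 by (simp add: field_simps)
    qed
    then show "- (2 * W * A\<^sup>2 * (ln (real k) / real k)\<^sup>2) \<le> peval \<psi> y"
      using y0(2)[OF y] by (simp only: h_def power_mult_distrib mult.assoc)
  qed
qed

section \<open>Polynomials in two groups of variables\<close>

lemma lookup_at_y: "lookup (at_y p y) \<alpha> = peval (lookup p \<alpha>) y"
  by (auto simp: at_y_def Poly_Mapping.map.rep_eq when_def)

lemma keys_at_y: "keys (at_y p y) \<subseteq> keys p"
  by (auto simp: in_keys_iff lookup_at_y)

lemma at_y_in_polys_le: "mdeg p \<le> k \<Longrightarrow> at_y p y \<in> polys_le k"
  using keys_at_y[of p y] by (auto simp: polys_le_iff mdeg_le_iff)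

lemma peval_apply_x:
  "peval (apply_x L p) y = (\<Sum>\<alpha>\<in>keys p. L (single \<alpha> 1) * peval (lookup p \<alpha>) y)"
  by (simp add: apply_x_def)

lemma apply_x_in_polys_le: "apply_x L p \<in> polys_le (mdeg_y p)"
  unfolding apply_x_def
proof (intro polys_le_sum polys_le_scale)
  fix \<alpha> assume "\<alpha> \<in> keys p"
  then have "mdeg (lookup p \<alpha>) \<le> mdeg_y p" unfolding mdeg_y_def by (intro Max_ge) auto
  then show "lookup p \<alpha> \<in> polys_le (mdeg_y p)" by (simp add: polys_le_def)
qed

lemma (in truncated_functional) L_at_y:
  assumes "mdeg p \<le> k"
  shows "L (at_y p y) = peval (apply_x L p) y"
proof -
  have "L (at_y p y) = (\<Sum>\<alpha>\<in>keys (at_y p y). peval (lookup p \<alpha>) y * L (single \<alpha> 1))"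
    by (simp add: L_expand[OF at_y_in_polys_le[OF assms]] lookup_at_y)
  also have "\<dots> = (\<Sum>\<alpha>\<in>keys p. peval (lookup p \<alpha>) y * L (single \<alpha> 1))"
    by (rule sum.mono_neutral_left) (use keys_at_y[of p y] in \<open>auto simp: in_keys_iff lookup_at_y\<close>)
  finally show ?thesis by (simp add: peval_apply_x mult.commute)
qed

text \<open>Exhibits p(u, y) as a polynomial in y, so that continuity in y is available.\<close>

lemma peval_at_y: "peval (at_y p y) u = peval (apply_x (\<lambda>h. peval h u) p) y"
proof -
  interpret truncated_functional "mdeg p" "\<lambda>h. peval h u"
    by unfold_locales (rule linear_functional_peval)
  show ?thesis by (rule L_at_y) simp
qed

text \<open>Compactness turns pointwise strictness into a uniform margin: the maximum over Y is
  attained. For empty Y there is no maximum and any margin will do.\<close>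

lemma slater_gap:
  assumes "compact Y" "\<And>y. y \<in> Y \<Longrightarrow> peval (at_y p y) u < 0"
  shows "\<exists>c>0. \<forall>y\<in>Y. peval (at_y p y) u \<le> - c"
proof (cases "Y = {}")
  case True
  then show ?thesis by (intro exI[of _ 1]) simp
next
  case False
  then obtain y0 where "y0 \<in> Y" "\<And>y. y \<in> Y \<Longrightarrow> peval (at_y p y) u \<le> peval (at_y p y0) u"
    using continuous_attains_sup[OF assms(1) _ continuous_on_peval] unfolding peval_at_y by blast
  then show ?thesis using assms(2) by (intro exI[of _ "- peval (at_y p y0) u"]) auto
qed

lemma apply_x_bounds:
  fixes p :: "('m::finite, ('n::finite, real) mpoly) mpoly"
  assumes "bounded Y" "B \<ge> 0" "mdeg p \<le> k"
  shows "\<exists>W>0. \<exists>M>0. \<forall>L. (\<forall>\<alpha>. mono_deg \<alpha> \<le> k \<longrightarrow> \<bar>L (single \<alpha> 1)\<bar> \<le> B) \<longrightarrow>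
    (\<forall>y\<in>Y. 2 * \<bar>peval (apply_x L p) y\<bar> \<le> W) \<and>
    (\<forall>y\<in>Y. \<forall>y'\<in>Y. \<bar>peval (apply_x L p) y - peval (apply_x L p) y'\<bar> \<le> M * norm (y - y'))"
proof -
  have "\<forall>\<alpha>. \<exists>b. b \<ge> 0 \<and> (\<forall>y\<in>Y. \<bar>peval (lookup p \<alpha>) y\<bar> \<le> b) \<and>
      (\<forall>y\<in>Y. \<forall>y'\<in>Y. \<bar>peval (lookup p \<alpha>) y - peval (lookup p \<alpha>) y'\<bar> \<le> b * norm (y - y'))"
    using peval_bounded_lipschitz[OF assms(1)] by auto
  from choice[OF this] obtain b where b: "\<And>\<alpha>. b \<alpha> \<ge> 0"
    "\<And>\<alpha> y. y \<in> Y \<Longrightarrow> \<bar>peval (lookup p \<alpha>) y\<bar> \<le> b \<alpha>"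
    "\<And>\<alpha> y y'. y \<in> Y \<Longrightarrow> y' \<in> Y \<Longrightarrow>
      \<bar>peval (lookup p \<alpha>) y - peval (lookup p \<alpha>) y'\<bar> \<le> b \<alpha> * norm (y - y')"
    by blast
  define S where "S = (\<Sum>\<alpha>\<in>keys p. B * b \<alpha>)"
  have S: "S \<ge> 0" unfolding S_def using b assms(2) by (intro sum_nonneg) auto
  show ?thesis
  \<comment> \<open>The factor 2 matches the bound on the oscillation that \<open>Pk_needle\<close>
    asks for; the summand 1 keeps both constants positive when S = 0.\<close>
  proof (intro exI[of _ "2 * S + 1"] conjI allI impI ballI)
    fix L :: "('m, real) mpoly \<Rightarrow> real" and y
    assume L: "\<forall>\<alpha>. mono_deg \<alpha> \<le> k \<longrightarrow> \<bar>L (single \<alpha> 1)\<bar> \<le> B" and y: "y \<in> Y"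
    have LB: "\<bar>L (single \<alpha> 1)\<bar> \<le> B" if "\<alpha> \<in> keys p" for \<alpha>
      using L assms(3) that by (auto simp: mdeg_le_iff)
    have "\<bar>peval (apply_x L p) y\<bar> \<le> S"
      unfolding peval_apply_x S_def
      by (rule order_trans[OF sum_abs sum_mono])
         (use LB b y assms(2) in \<open>auto simp: abs_mult intro!: mult_mono\<close>)
    then show "2 * \<bar>peval (apply_x L p) y\<bar> \<le> 2 * S + 1" by simp
    fix y' assume y': "y' \<in> Y"
    have "peval (apply_x L p) y - peval (apply_x L p) y'
        = (\<Sum>\<alpha>\<in>keys p. L (single \<alpha> 1) * (peval (lookup p \<alpha>) y - peval (lookup p \<alpha>) y'))"
      by (simp add: peval_apply_x sum_subtractf right_diff_distrib)
    also have "\<bar>\<dots>\<bar> \<le> (\<Sum>\<alpha>\<in>keys p. B * (b \<alpha> * norm (y - y')))"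
      by (rule order_trans[OF sum_abs sum_mono])
         (use LB b y y' assms(2) in \<open>auto simp: abs_mult intro!: mult_mono\<close>)
    also have "\<dots> = S * norm (y - y')" by (simp add: S_def sum_distrib_right mult.assoc)
    also have "\<dots> \<le> (2 * S + 1) * norm (y - y')" using S by (intro mult_right_mono) auto
    finally show "\<bar>peval (apply_x L p) y - peval (apply_x L p) y'\<bar> \<le> (2 * S + 1) * norm (y - y')" .
  qed (use S in simp_all)
qed

text \<open>The moment bound depends on R and d only, so W and M, and with them C and k0, are fixed
  before L is chosen. Jensen then gives p(u, y) \<le> L(p(x, y)), to which the lower bound for -
  L(p(x, y)) applies.\<close>

lemma constraint_violation:
  fixes p :: "('m::finite, ('n::finite, real) mpoly) mpoly"
  assumes Y: "compact Y" and p: "mdeg p \<le> 2 * d" "\<forall>y\<in>Y. sos_convex (at_y p y)"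
    and A5: "\<exists>\<epsilon>Y>0. \<exists>\<eta>Y>0. \<forall>y\<in>Y. \<forall>\<delta>. 0 < \<delta> \<and> \<delta> < \<epsilon>Y \<longrightarrow>
               measure lborel (cball y \<delta> \<inter> Y) \<ge> \<eta>Y * measure lborel (cball y \<delta>)"
  shows "\<exists>C\<ge>0. \<exists>k0. \<forall>k\<ge>k0. \<forall>L. ball_functional d L R \<longrightarrow> L 1 = 1 \<longrightarrow>
    - apply_x L p \<in> Pk (mdeg_y p) Y k \<longrightarrow>
    (\<forall>y\<in>Y. peval (at_y p y) (point_of L) \<le> C * (ln (real k) / real k)\<^sup>2)"
proof -
  define B where "B = (max 1 (R\<^sup>2)) ^ d"
  have "B \<ge> 0" by (simp add: B_def)
  then obtain W M where W: "W > 0" and M: "M > 0"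
    and WM: "\<And>L. \<forall>\<alpha>. mono_deg \<alpha> \<le> 2 * d \<longrightarrow> \<bar>L (single \<alpha> 1)\<bar> \<le> B \<Longrightarrow>
      (\<forall>y\<in>Y. 2 * \<bar>peval (apply_x L p) y\<bar> \<le> W) \<and>
      (\<forall>y\<in>Y. \<forall>y'\<in>Y. \<bar>peval (apply_x L p) y - peval (apply_x L p) y'\<bar> \<le> M * norm (y - y'))"
    using apply_x_bounds[OF compact_imp_bounded[OF Y] _ p(1), of B] by blast
  from A5 obtain \<epsilon>Y \<eta>Y where e: "\<epsilon>Y > 0" "\<eta>Y > 0" "\<And>y \<delta>. y \<in> Y \<Longrightarrow> 0 < \<delta> \<Longrightarrow> \<delta> < \<epsilon>Y \<Longrightarrow>
      measure lborel (cball y \<delta> \<inter> Y) \<ge> \<eta>Y * measure lborel (cball y \<delta>)" by blast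
  obtain C k0 where C: "C \<ge> 0" and lower: "\<And>k \<psi> y. k \<ge> k0 \<Longrightarrow> \<psi> \<in> Pk (mdeg_y p) Y k \<Longrightarrow>
     (\<forall>y\<in>Y. 2 * \<bar>peval \<psi> y\<bar> \<le> W) \<Longrightarrow>
     (\<forall>y\<in>Y. \<forall>y'\<in>Y. \<bar>peval \<psi> y - peval \<psi> y'\<bar> \<le> M * norm (y - y')) \<Longrightarrow> y \<in> Y \<Longrightarrow>
     peval \<psi> y \<ge> - (C * (ln (real k) / real k)\<^sup>2)"
    using Pk_lower_bound[OF Y W M e, of "mdeg_y p"] by blast
  show ?thesis
  proof (intro exI[of _ C] exI[of _ k0] conjI allI impI ballI C)
    fix k L y
    assume k: "k0 \<le> k" and L: "ball_functional d L R" "L 1 = 1"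
      and P: "- apply_x L p \<in> Pk (mdeg_y p) Y k" and y: "y \<in> Y"
    interpret ball_functional d L R by (rule L(1))
    have "\<forall>\<alpha>. mono_deg \<alpha> \<le> 2 * d \<longrightarrow> \<bar>L (single \<alpha> 1)\<bar> \<le> B"
      using moment_bound L(2) by (simp add: B_def)
    note b = WM[OF this]
    have "peval (- apply_x L p) y \<ge> - (C * (ln (real k) / real k)\<^sup>2)"
      by (rule lower[OF k P _ _ y]) (use b in \<open>simp_all add: abs_minus_commute\<close>)
    moreover have "peval (at_y p y) (point_of L) \<le> L (at_y p y)"
      using p(2) y by (intro jensen_sos_convex[OF linear d_pos sos_nonneg L(2) at_y_in_polys_le[OF p(1)]]) auto
    ultimately show "peval (at_y p y) (point_of L) \<le> C * (ln (real k) / real k)\<^sup>2"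
      by (simp add: L_at_y[OF p(1)])
  qed
qed

lemma Pk_scale:
  assumes "\<psi> \<in> Pk D Y k" "c \<ge> 0"
  shows "mconst c * \<psi> \<in> Pk D Y k"
proof -
  have "(LINT y:Y|lborel. peval (mconst c * \<psi>) y * peval \<sigma> y)
      = c * (LINT y:Y|lborel. peval \<psi> y * peval \<sigma> y)" for \<sigma>
    by (simp add: mult.assoc)
  then show ?thesis using assms by (auto simp: Pk_def intro: polys_le_scale)
qed

lemma apply_x_scale:
  fixes p :: "('m::finite, ('n::finite, real) mpoly) mpoly"
  shows "apply_x (\<lambda>h. c * L h) p = mconst c * apply_x L p"
  by (rule peval_inject) (simp add: peval_apply_x sum_distrib_left mult.assoc)

section \<open>The feasible set\<close>

text \<open>The Hessian vanishes, so H with no rows serves. In the affine case of A2 this gives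
  Jensen for both g and - g, hence equality.\<close>

lemma sos_convex_affine:
  assumes "mdeg g \<le> 1"
  shows "sos_convex g"
proof -
  have 1: "keys (pderiv_at j g) \<subseteq> {0}" for j
  proof -
    have "keys (single (\<alpha> - single j 1) (of_nat (lookup \<alpha> j) * lookup g \<alpha>)) \<subseteq> {0}"
      if "\<alpha> \<in> keys g" for \<alpha>
    proof (cases "lookup \<alpha> j = 0")
      case False
      have "mono_deg \<alpha> \<le> 1" using that assms by (simp add: mdeg_le_iff)
      moreover have "\<alpha> = (\<alpha> - single j 1) + single j 1"
        by (rule poly_mapping_eqI)
           (use False in \<open>auto simp: lookup_add lookup_minus lookup_single when_def\<close>)
      then have "mono_deg \<alpha> = mono_deg (\<alpha> - single j 1) + 1"
        by (metis mono_deg_add mono_deg_single)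
      ultimately have "\<alpha> - single j 1 = 0" by simp
      then show ?thesis by simp
    qed simp
    then show ?thesis
      unfolding pderiv_at_def using Poly_Mapping.keys_sum by fastforce
  qed
  have "pderiv_at i (pderiv_at j g) = 0" for i j
    unfolding pderiv_at_def[of i "pderiv_at j g"]
    by (rule sum.neutral) (use 1[of j] in auto)
  then show ?thesis
    unfolding sos_convex_def by (intro exI[of _ "0::nat"]) simp
qed

text \<open>The weight t solves (1 - t) \<epsilon> = t c: the margin of the Slater point then
  exactly compensates the violation at u.\<close>

lemma feasible_set_repair:
  assumes conv: "\<forall>j\<in>{1..s}. sos_convex (\<phi> j)" "\<forall>y\<in>Y. sos_convex (at_y p y)"
    and u: "\<forall>j\<in>{1..s}. peval (\<phi> j) u \<le> 0" "\<forall>y\<in>Y. peval (at_y p y) u \<le> \<epsilon>"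
    and u0: "u0 \<in> feasible_set \<phi> s p Y" "\<forall>y\<in>Y. peval (at_y p y) u0 \<le> - c"
    and "\<epsilon> \<ge> 0" "c > 0" and t: "t = \<epsilon> / (\<epsilon> + c)"
  shows "(1 - t) *\<^sub>R u + t *\<^sub>R u0 \<in> feasible_set \<phi> s p Y"
proof -
  have t01: "0 \<le> t" "t \<le> 1" using assms by auto
  have "peval (\<phi> j) ((1 - t) *\<^sub>R u + t *\<^sub>R u0) \<le> 0" if "j \<in> {1..s}" for j
  proof -
    have "(1 - t) * peval (\<phi> j) u + t * peval (\<phi> j) u0 \<le> (1 - t) * 0 + t * 0"
      using t01 u u0(1) that by (intro add_mono mult_left_mono) (auto simp: feasible_set_def)
    then show ?thesis using sos_convex_peval_le[of "\<phi> j" t u u0] conv that t01 by fastforce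
  qed
  moreover have "peval (at_y p y) ((1 - t) *\<^sub>R u + t *\<^sub>R u0) \<le> 0" if "y \<in> Y" for y
  proof -
    have "(1 - t) * peval (at_y p y) u + t * peval (at_y p y) u0 \<le> (1 - t) * \<epsilon> + t * (- c)"
      using t01 u u0(2) that by (intro add_mono mult_left_mono) auto
    also have "\<dots> = 0" using assms(7,8) by (simp add: t field_simps)
    finally show ?thesis using sos_convex_peval_le[of "at_y p y" t u u0] conv that t01 by fastforce
  qed
  ultimately show ?thesis by (simp add: feasible_set_def)
qed

lemma convex_feasible_set:
  assumes conv: "\<forall>j\<in>{1..s}. sos_convex (\<phi> j)" "\<forall>y\<in>Y. sos_convex (at_y p y)"
  shows "convex (feasible_set \<phi> s p Y)"
proof (rule convexI)
  have *: "peval h (a *\<^sub>R x + b *\<^sub>R z) \<le> 0"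
    if "sos_convex h" "peval h x \<le> 0" "peval h z \<le> 0" "0 \<le> a" "0 \<le> b" "a + b = 1" for h x z a b
  proof -
    have "a = 1 - b" using that by simp
    have "a * peval h x + b * peval h z \<le> a * 0 + b * 0"
      using that by (intro add_mono mult_left_mono) auto
    then show ?thesis
      using sos_convex_peval_le[of h b x z] that unfolding \<open>a = 1 - b\<close> by simp
  qed
  show "a *\<^sub>R x + b *\<^sub>R z \<in> feasible_set \<phi> s p Y"
    if "x \<in> feasible_set \<phi> s p Y" "z \<in> feasible_set \<phi> s p Y" "0 \<le> a" "0 \<le> b" "a + b = 1" for x z a b
    using that conv by (auto simp: feasible_set_def intro!: *)
qed

lemma closed_feasible_set: "closed (feasible_set \<phi> s p Y)"
proof -
  have "feasible_set \<phi> s p Y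
      = (\<Inter>j\<in>{1..s}. {x. peval (\<phi> j) x \<le> 0}) \<inter> (\<Inter>y\<in>Y. {x. peval (at_y p y) x \<le> 0})"
    by (auto simp: feasible_set_def)
  then show ?thesis
    by (auto intro!: closed_INT closed_Int closed_Collect_le continuous_intros)
qed

text \<open>Either some point of \<open>K\<close> lies in the open ball, and the bound is linear in \<open>e\<close>; or the
  intersection is a single point, and the strict convexity of the ball yields the square root.\<close>

lemma infdist_Int_cball:
  fixes K :: "'a::euclidean_space set"
  assumes K: "convex K" "closed K" and x: "x \<in> K" "norm x \<le> R" and R: "R > 0"
  shows "\<exists>C\<ge>0. \<forall>e u. 0 \<le> e \<longrightarrow> e \<le> 1 \<longrightarrow> u \<in> K \<longrightarrow> norm u \<le> R + e \<longrightarrow>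
    infdist u (K \<inter> cball 0 R) \<le> C * sqrt e"
proof -
  \<comment> \<open>The point of K of least norm decides the case: K meets the open ball iff it lies
    there.\<close>
  define m where "m = closest_point K 0"
  have m: "m \<in> K" unfolding m_def using x by (intro closest_point_in_set K) auto
  have mx: "norm m \<le> norm x"
    using closest_point_le[OF K(2) x(1), of 0] by (simp add: m_def)
  show ?thesis
  proof (cases "norm m < R")
    case True
    define D where "D = R - norm m"
    have D: "D > 0" using True by (simp add: D_def)
    show ?thesis
    proof (intro exI[of _ "(2 * R + 1) / D"] conjI allI impI)
      show "0 \<le> (2 * R + 1) / D" using R D by simp
    next
      fix e u assume e: "0 \<le> e" "e \<le> (1::real)" and u: "u \<in> K" "norm u \<le> R + e"
      \<comment> \<open>Solves (1 - \<tau>) (R + e) + \<tau> norm m = R, so moving from u towards m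
        ends in the ball.\<close>
      define \<tau> where "\<tau> = e / (e + D)"
      have \<tau>: "0 \<le> \<tau>" "\<tau> \<le> 1" "\<tau> \<le> e / D"
        using e D by (auto simp: \<tau>_def intro!: divide_left_mono)
      define z where "z = (1 - \<tau>) *\<^sub>R u + \<tau> *\<^sub>R m"
      have "z \<in> K" unfolding z_def using K(1) u m \<tau> by (intro convexD) auto
      moreover have "norm z \<le> R"
      proof -
        have "norm z \<le> (1 - \<tau>) * norm u + \<tau> * norm m"
          unfolding z_def using \<tau> by (intro norm_triangle_le) simp
        also have "\<dots> \<le> (1 - \<tau>) * (R + e) + \<tau> * norm m"
          using \<tau> u by (intro add_mono mult_left_mono) auto
        also have "\<dots> = R + (e - \<tau> * (e + D))" by (simp add: D_def algebra_simps)
        also have "\<tau> * (e + D) = e" using e D by (simp add: \<tau>_def)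
        finally show ?thesis by simp
      qed
      moreover have "dist u z \<le> (2 * R + 1) / D * sqrt e"
      proof -
        have "u - z = \<tau> *\<^sub>R (u - m)" by (simp add: z_def algebra_simps)
        then have "dist u z = \<tau> * norm (u - m)" using \<tau> by (simp add: dist_norm)
        also have "\<dots> \<le> e / D * (2 * R + 1)"
          using \<tau> u e True norm_triangle_ineq4[of u m] by (intro mult_mono) auto
        also have "\<dots> \<le> sqrt e / D * (2 * R + 1)"
        proof -
          have "e \<le> sqrt e" using e by (intro real_le_rsqrt) (simp add: power2_eq_square mult_left_le)
          then show ?thesis using D R by (intro mult_right_mono divide_right_mono) auto
        qed
        finally show ?thesis by (simp add: field_simps)
      qed
      ultimately show "infdist u (K \<inter> cball 0 R) \<le> (2 * R + 1) / D * sqrt e"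
        by (intro infdist_le2[of z]) auto
    qed
  next
    case False
    then have mR: "norm m = R" using mx x by simp
    show ?thesis
    proof (intro exI[of _ "sqrt (2 * R + 1)"] conjI allI impI)
      show "0 \<le> sqrt (2 * R + 1)" using R by simp
    next
      fix e u assume e: "0 \<le> e" "e \<le> (1::real)" and u: "u \<in> K" "norm u \<le> R + e"
      \<comment> \<open>The obtuse angle at the projection m of 0 gives norm (u - m)^2 \<le> (norm
        u)^2 - R^2, which is of order e.\<close>
      have "inner (0 - m) (u - m) \<le> 0"
        unfolding m_def by (intro closest_point_dot K u)
      then have mu: "R\<^sup>2 \<le> inner m u"
        by (simp add: inner_diff_right power2_norm_eq_inner flip: mR)
      have "(norm (u - m))\<^sup>2 = (norm u)\<^sup>2 - 2 * inner m u + R\<^sup>2"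
        by (simp add: power2_norm_eq_inner inner_diff_left inner_diff_right inner_commute flip: mR)
      also have "\<dots> \<le> (R + e)\<^sup>2 - R\<^sup>2"
        using mu power_mono[OF u(2), of 2] by simp
      also have "\<dots> = 2 * R * e + e * e" by (simp add: power2_eq_square algebra_simps)
      also have "\<dots> \<le> (2 * R + 1) * e"
        using mult_left_mono[OF e(2) e(1)] by (simp add: algebra_simps)
      finally have "norm (u - m) \<le> sqrt ((2 * R + 1) * e)" by (rule real_le_rsqrt)
      then show "infdist u (K \<inter> cball 0 R) \<le> sqrt (2 * R + 1) * sqrt e"
        using m mR by (intro infdist_le2[of m]) (auto simp: dist_norm real_sqrt_mult)
    qed
  qed
qed

lemma half_degree_bounds:
  assumes "d = half_degree f g \<phi> s p"
  shows "mdeg f \<le> 2 * d" "mdeg g \<le> 2 * d" "mdeg p \<le> 2 * d" "\<And>j. j \<in> {1..s} \<Longrightarrow> mdeg (\<phi> j) \<le> 2 * d"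
proof -
  define A where "A = {mdeg f, mdeg g, mdeg p} \<union> (\<lambda>j. mdeg (\<phi> j)) ` {1..s}"
  have "n \<le> 2 * d" if "n \<in> A" for n
  proof -
    have "n \<le> Max A" by (rule Max_ge) (use that in \<open>auto simp: A_def\<close>)
    moreover have "real (Max A) / 2 \<le> real d"
      unfolding assms half_degree_def A_def[symmetric] by linarith
    ultimately show ?thesis by linarith
  qed
  then show "mdeg f \<le> 2 * d" "mdeg g \<le> 2 * d" "mdeg p \<le> 2 * d" "\<And>j. j \<in> {1..s} \<Longrightarrow> mdeg (\<phi> j) \<le> 2 * d"
    by (auto simp: A_def)
qed

section \<open>Rates for the two relaxations\<close>

lemma eventually_rate_le:
  assumes "G \<ge> 0"
  shows "\<exists>k0. \<forall>k\<ge>k0. 0 \<le> ln (real k) / real k \<and> ln (real k) / real k \<le> 1 \<and>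
    G * (ln (real k) / real k)\<^sup>2 \<le> 1"
proof -
  have lim: "(\<lambda>k. ln (real k) / real k) \<longlonglongrightarrow> 0" by (rule lim_ln_over_n)
  then have "(\<lambda>k. G * (ln (real k) / real k)\<^sup>2) \<longlonglongrightarrow> G * 0\<^sup>2" by (intro tendsto_intros)
  then have "eventually (\<lambda>k. G * (ln (real k) / real k)\<^sup>2 < 1) sequentially"
    by (rule order_tendstoD) simp
  then have "eventually (\<lambda>k. 0 \<le> ln (real k) / real k \<and> ln (real k) / real k \<le> 1 \<and>
      G * (ln (real k) / real k)\<^sup>2 \<le> 1) sequentially"
    using eventually_ge_at_top[of 1] by eventually_elim (simp add: ln_bound)
  then show ?thesis by (simp add: eventually_sequentially)
qed

text \<open>With q = ln k / k the repaired point is in K, within G q^2 of u, so its norm is at most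
  R + G q^2. Applying \<open>infdist_Int_cball\<close> with e = G q^2 leaves a multiple of sqrt G q,
  which also dominates the first move once G q^2 \<le> 1.\<close>

lemma infdist_Lambda_rate:
  fixes p :: "('m::finite, ('n::finite, real) mpoly) mpoly"
  assumes Y: "compact Y" and d: "1 \<le> d" and R: "R > 0"
    and deg: "mdeg p \<le> 2 * d" "\<And>j. j \<in> {1..s} \<Longrightarrow> mdeg (\<phi> j) \<le> 2 * d"
    and conv: "\<forall>j\<in>{1..s}. sos_convex (\<phi> j)" "\<forall>y\<in>Y. sos_convex (at_y p y)"
    and u0: "u0 \<in> feasible_set \<phi> s p Y" "c > 0" "\<forall>y\<in>Y. peval (at_y p y) u0 \<le> - c"
    and x: "x \<in> feasible_set \<phi> s p Y" "norm x \<le> R"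
    and C: "C \<ge> 0" "\<And>k L. k \<ge> k0 \<Longrightarrow> ball_functional d L R \<Longrightarrow> L 1 = 1 \<Longrightarrow>
      - apply_x L p \<in> Pk (mdeg_y p) Y k \<Longrightarrow>
      \<forall>y\<in>Y. peval (at_y p y) (point_of L) \<le> C * (ln (real k) / real k)\<^sup>2"
  shows "\<exists>C' k1. \<forall>k\<ge>k1. \<forall>u\<in>Lambda \<phi> s p Y R d k.
     infdist u (feasible_set \<phi> s p Y \<inter> cball 0 R) \<le> C' * (ln (real k) / real k)"
proof -
  define K where "K = feasible_set \<phi> s p Y"
  obtain C2 where C2: "C2 \<ge> 0" "\<And>e u. 0 \<le> e \<Longrightarrow> e \<le> 1 \<Longrightarrow> u \<in> K \<Longrightarrow> norm u \<le> R + e \<Longrightarrow>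
      infdist u (K \<inter> cball 0 R) \<le> C2 * sqrt e"
    using infdist_Int_cball[OF convex_feasible_set[OF conv] closed_feasible_set x R]
    unfolding K_def by blast
  \<comment> \<open>The repair weight is at most C q^2 / c, and the distance from u to the Slater
    point at most R + norm u0.\<close>
  define G where "G = C / c * (R + norm u0)"
  have G: "G \<ge> 0" using C u0 R by (simp add: G_def)
  obtain k1 where k1: "\<And>k. k \<ge> k1 \<Longrightarrow> 0 \<le> ln (real k) / real k \<and> ln (real k) / real k \<le> 1 \<and>
      G * (ln (real k) / real k)\<^sup>2 \<le> 1"
    using eventually_rate_le[OF G] by blast
  show ?thesis
  proof (intro exI[of _ "(C2 + 1) * sqrt G"] exI[of _ "max k0 k1"] allI impI ballI)
    fix k u assume k: "max k0 k1 \<le> k" and "u \<in> Lambda \<phi> s p Y R d k"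
    then obtain L where u: "u = point_of L" and lin: "linear_functional (2 * d) L"
      and pos: "\<forall>\<sigma>\<in>sos_le d. L \<sigma> \<ge> 0"
      and ball: "\<forall>\<sigma>\<in>sos_le (d - 1). L ((mconst (R\<^sup>2) - sqnorm_poly) * \<sigma>) \<ge> 0"
      and P: "- apply_x L p \<in> Pk (mdeg_y p) Y k" and one: "L 1 = 1"
      and L\<phi>: "\<forall>j\<in>{1..s}. L (\<phi> j) \<le> 0"
      unfolding Lambda_def by blast
    interpret ball_functional d L R
      by unfold_locales (use lin pos ball d in auto)
    define q where "q = ln (real k) / real k"
    have q: "0 \<le> q" "G * q\<^sup>2 \<le> 1" using k1[of k] k by (auto simp: q_def)
    have phi: "\<forall>j\<in>{1..s}. peval (\<phi> j) u \<le> 0"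
    proof
      fix j assume j: "j \<in> {1..s}"
      have "peval (\<phi> j) u \<le> L (\<phi> j)"
        unfolding u using conv(1) deg(2)[OF j] j
        by (intro jensen_sos_convex[OF lin d sos_nonneg one]) (auto simp: polys_le_def)
      then show "peval (\<phi> j) u \<le> 0" using L\<phi> j by fastforce
    qed
    have viol: "\<forall>y\<in>Y. peval (at_y p y) u \<le> C * q\<^sup>2"
      unfolding u q_def by (rule C(2)) (use k one P in \<open>auto intro: ball_functional_axioms\<close>)
    have nu: "norm u \<le> R" unfolding u using one R by (intro norm_point_of_le) auto
    define t where "t = C * q\<^sup>2 / (C * q\<^sup>2 + c)"
    define u' where "u' = (1 - t) *\<^sub>R u + t *\<^sub>R u0"
    have Cq: "0 \<le> C * q\<^sup>2" using C by simp
    have u': "u' \<in> K"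
      unfolding u'_def K_def by (rule feasible_set_repair[OF conv phi viol u0(1,3) Cq u0(2) t_def])
    have t: "0 \<le> t" "t \<le> C * q\<^sup>2 / c"
      using Cq u0(2) by (auto simp: t_def intro!: divide_left_mono)
    have du: "dist u u' \<le> G * q\<^sup>2"
    proof -
      have "u - u' = t *\<^sub>R (u - u0)" by (simp add: u'_def algebra_simps)
      then have "dist u u' = t * norm (u - u0)" using t by (simp add: dist_norm)
      also have "\<dots> \<le> C * q\<^sup>2 / c * (R + norm u0)"
        using t nu norm_triangle_ineq4[of u u0] Cq u0(2) by (intro mult_mono) auto
      finally show ?thesis by (simp add: G_def mult.commute mult.left_commute)
    qed
    have "norm u' \<le> norm u + dist u u'"
      by (metis dist_commute dist_norm norm_triangle_sub)
    then have nu': "norm u' \<le> R + G * q\<^sup>2" using nu du by linarith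
    have sq: "sqrt (G * q\<^sup>2) = sqrt G * q" using q by (simp add: real_sqrt_mult)
    have le_sqrt: "G * q\<^sup>2 \<le> sqrt G * q"
    proof -
      have "G * q\<^sup>2 \<le> sqrt (G * q\<^sup>2)"
        using q G by (intro real_le_rsqrt) (simp add: power2_eq_square mult_left_le)
      then show ?thesis by (simp only: sq)
    qed
    have "infdist u (K \<inter> cball 0 R) \<le> infdist u' (K \<inter> cball 0 R) + dist u u'"
      by (rule infdist_triangle)
    also have "infdist u' (K \<inter> cball 0 R) \<le> C2 * sqrt (G * q\<^sup>2)"
      using G q u' nu' by (intro C2(2)) auto
    finally have "infdist u (K \<inter> cball 0 R) \<le> C2 * (sqrt G * q) + sqrt G * q"
      using du le_sqrt by (simp only: sq) linarith
    then show "infdist u (feasible_set \<phi> s p Y \<inter> cball 0 R) \<le> (C2 + 1) * sqrt G * (ln (real k) / real k)"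
      by (simp only: q_def[symmetric] K_def[symmetric]) (simp add: algebra_simps)
  qed
qed

section \<open>The optimal value of the dual relaxation\<close>

definition dual_feasible ::
  "('m::finite, real) mpoly \<Rightarrow> (nat \<Rightarrow> ('m, real) mpoly) \<Rightarrow> nat
    \<Rightarrow> ('m, ('n::finite, real) mpoly) mpoly \<Rightarrow> (real ^ 'n) set \<Rightarrow> real \<Rightarrow> real \<Rightarrow> nat \<Rightarrow> nat
    \<Rightarrow> (('m, real) mpoly \<Rightarrow> real) set" where
  "dual_feasible g \<phi> s p Y R gstar d k = {L. linear_functional (2 * d) L \<and>
          (\<forall>h \<in> quad_module_le d (mconst (R\<^sup>2) - sqnorm_poly) (g - mconst gstar). L h \<ge> 0) \<and>
          L g = 1 \<and>
          - apply_x L p \<in> Pk (mdeg_y p) Y k \<and>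
          (\<forall>j\<in>{1..s}. L (\<phi> j) \<le> 0)}"

lemma r_dual_altdef:
  "r_dual f g \<phi> s p Y R gstar d k = (INF L\<in>dual_feasible g \<phi> s p Y R gstar d k. ereal (L f))"
  by (simp add: r_dual_def dual_feasible_def)

lemma zero_in_sos: "0 \<in> sos"
  unfolding sos_def by (intro CollectI exI[of _ "0::nat"]) simp

lemma one_in_sos: "(1 :: ('v::finite, real) mpoly) \<in> sos"
  using power2_in_sos_le[of "1 :: ('v, real) mpoly" 0] by (simp add: sos_le_def)

lemma mdeg_0 [simp]: "mdeg 0 = 0"
  by (simp add: mdeg_def)

text \<open>Its objective value is f(u) / g(u). Taken at a minimizer in the ball with g(u) \<ge>
  gstar, it shows that the relaxation never exceeds the optimal value.\<close>

lemma scaled_peval_dual_feasible: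
  assumes u: "u \<in> feasible_set \<phi> s p Y" "norm u \<le> R" "peval g u \<ge> gstar" "gstar > 0"
  shows "(\<lambda>h. peval h u / peval g u) \<in> dual_feasible g \<phi> s p Y R gstar d k"
proof -
  define \<mu> where "\<mu> = 1 / peval g u"
  have l: "\<mu> > 0" using u by (simp add: \<mu>_def)
  have L: "(\<lambda>h. peval h u / peval g u) = (\<lambda>h. \<mu> * peval h u)" by (simp add: \<mu>_def)
  have "linear_functional (2 * d) (\<lambda>h. \<mu> * peval h u)"
    by (simp add: linear_functional_def algebra_simps)
  moreover have "\<mu> * peval h u \<ge> 0"
    if "h \<in> quad_module_le d (mconst (R\<^sup>2) - sqnorm_poly) (g - mconst gstar)" for h
  proof -
    have "(norm u)\<^sup>2 \<le> R\<^sup>2" using u(2) by (intro power_mono) auto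
    then show ?thesis
      using that l u(3) by (auto simp: quad_module_le_def peval_sqnorm_poly sos_peval_nonneg)
  qed
  moreover have "- apply_x (\<lambda>h. \<mu> * peval h u) p \<in> Pk (mdeg_y p) Y k"
  proof -
    have "(LINT y:Y|lborel. peval (- apply_x (\<lambda>h. \<mu> * peval h u) p) y * peval \<sigma> y) \<ge> 0"
      if "\<sigma> \<in> sos_le k" for \<sigma>
      unfolding set_lebesgue_integral_def
    proof (rule integral_nonneg_AE, rule AE_I2)
      fix y
      show "0 \<le> indicat_real Y y *\<^sub>R (peval (- apply_x (\<lambda>h. \<mu> * peval h u) p) y * peval \<sigma> y)"
      proof (cases "y \<in> Y")
        case True
        then have "peval (at_y p y) u \<le> 0" using u(1) by (simp add: feasible_set_def)
        then have "- (\<mu> * peval (at_y p y) u) \<ge> 0" using l by (simp add: mult_le_0_iff)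
        moreover have "peval \<sigma> y \<ge> 0" using that by (simp add: sos_le_def sos_peval_nonneg)
        ultimately have "0 \<le> - (\<mu> * peval (at_y p y) u) * peval \<sigma> y" by (rule mult_nonneg_nonneg)
        then show ?thesis using True by (simp add: apply_x_scale peval_at_y)
      qed simp
    qed
    then show ?thesis by (simp add: Pk_def polys_le_uminus apply_x_in_polys_le)
  qed
  moreover have "\<mu> * peval (\<phi> j) u \<le> 0" if "j \<in> {1..s}" for j
    using that u(1) l by (auto simp: feasible_set_def mult_le_0_iff)
  moreover have "\<mu> * peval g u = 1" using u by (simp add: \<mu>_def)
  ultimately show ?thesis unfolding L dual_feasible_def by auto
qed

text \<open>If L 1 were 0, the moment bounds would make L vanish, against L g = 1. The upper bound
  on L 1 comes from the generator g - gstar.\<close>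

lemma dual_feasible_normalize:
  assumes d: "1 \<le> d" and g: "mdeg g \<le> 2 * d" and gstar: "gstar > 0"
    and L: "L \<in> dual_feasible g \<phi> s p Y R gstar d k"
  shows "0 < L 1" "L 1 \<le> 1 / gstar" "ball_functional d (\<lambda>h. 1 / L 1 * L h) R"
    "- apply_x (\<lambda>h. 1 / L 1 * L h) p \<in> Pk (mdeg_y p) Y k"
proof -
  have lin: "linear_functional (2 * d) L" and Lg: "L g = 1"
    and quad: "\<And>h. h \<in> quad_module_le d (mconst (R\<^sup>2) - sqnorm_poly) (g - mconst gstar) \<Longrightarrow> L h \<ge> 0"
    and P: "- apply_x L p \<in> Pk (mdeg_y p) Y k"
    using L by (auto simp: dual_feasible_def)
  have sos: "L \<sigma> \<ge> 0" if "\<sigma> \<in> sos_le d" for \<sigma>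
    unfolding quad_module_le_def using that zero_in_sos
    by (intro quad[unfolded quad_module_le_def] CollectI exI[of _ \<sigma>] exI[of _ 0] conjI)
       (auto simp: sos_le_def)
  have ball: "L ((mconst (R\<^sup>2) - sqnorm_poly) * \<sigma>) \<ge> 0" if "\<sigma> \<in> sos_le (d - 1)" for \<sigma>
  proof (rule quad)
    have "mconst (R\<^sup>2) - sqnorm_poly \<in> polys_le (2 * 1)"
      by (intro polys_le_diff polys_le_mconst sqnorm_poly_in_polys_le) simp
    moreover have "\<sigma> \<in> polys_le (2 * (d - 1))" using that by (simp add: sos_le_def polys_le_def)
    ultimately have "\<sigma> * (mconst (R\<^sup>2) - sqnorm_poly) \<in> polys_le (2 * (d - 1) + 2 * 1)"
      by (intro polys_le_mult)
    then have "mdeg (\<sigma> * (mconst (R\<^sup>2) - sqnorm_poly)) \<le> 2 * d"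
      using d by (simp add: polys_le_def algebra_simps)
    then show "(mconst (R\<^sup>2) - sqnorm_poly) * \<sigma>
        \<in> quad_module_le d (mconst (R\<^sup>2) - sqnorm_poly) (g - mconst gstar)"
      unfolding quad_module_le_def using that zero_in_sos
      by (intro CollectI exI[of _ 0] exI[of _ \<sigma>] conjI) (auto simp: sos_le_def mult.commute)
  qed
  interpret ball_functional d L R
    by unfold_locales (use lin sos ball d in auto)
  have g_le: "g \<in> polys_le (2 * d)" using g by (simp add: polys_le_def)
  \<comment> \<open>The multiplier of g - gstar is the constant 1, so only the degree of g has to
    fit.\<close>
  have "0 \<le> L (g - mconst gstar)"
  proof (rule quad)
    have "g - mconst gstar \<in> polys_le (2 * d)" by (intro polys_le_diff g_le) simp
    then show "g - mconst gstar \<in> quad_module_le d (mconst (R\<^sup>2) - sqnorm_poly) (g - mconst gstar)"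
      unfolding quad_module_le_def using zero_in_sos one_in_sos
      by (intro CollectI exI[of _ 0] exI[of _ 1] conjI) (auto simp: polys_le_def)
  qed
  then have "gstar * L 1 \<le> 1" by (simp add: L_diff g_le L_mconst Lg)
  then show "L 1 \<le> 1 / gstar" using gstar by (simp add: field_simps)
  have "L 1 \<noteq> 0" using L_eq_0[OF _ g_le] Lg by auto
  then show pos: "0 < L 1" using L_1_nonneg by simp
  show "ball_functional d (\<lambda>h. 1 / L 1 * L h) R"
  proof
    show "linear_functional (2 * d) (\<lambda>h. 1 / L 1 * L h)"
      using linear_functional_combination[OF lin lin, of "1 / L 1" 0] by simp
  qed (use pos sos ball d in auto)
  have "- apply_x (\<lambda>h. 1 / L 1 * L h) p = mconst (1 / L 1) * (- apply_x L p)"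
    by (simp only: apply_x_scale mult_minus_right)
  then show "- apply_x (\<lambda>h. 1 / L 1 * L h) p \<in> Pk (mdeg_y p) Y k"
    using Pk_scale[OF P, of "1 / L 1"] pos by simp
qed

text \<open>With r the optimal value, f - r g is nonnegative on K. Evaluating this at the repaired
  point gives f(u) \<ge> r g(u) - \<epsilon> F / c, where F is the slack f - r g at the Slater
  point. Jensen for f and - g transfers it to L f, and L 1 \<le> 1 / gstar bounds the error, which
  stays linear in \<epsilon>.\<close>

lemma dual_feasible_rate:
  fixes p :: "('m::finite, ('n::finite, real) mpoly) mpoly"
  assumes d: "1 \<le> d" and deg: "mdeg f \<le> 2 * d" "mdeg g \<le> 2 * d" "\<And>j. j \<in> {1..s} \<Longrightarrow> mdeg (\<phi> j) \<le> 2 * d"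
    and K: "K = feasible_set \<phi> s p Y"
    and conv: "\<forall>j\<in>{1..s}. sos_convex (\<phi> j)" "\<forall>y\<in>Y. sos_convex (at_y p y)"
    and fg: "sos_convex f" "sos_convex (- g)"
    and A2: "(\<forall>x\<in>K. peval f x \<ge> 0 \<and> peval g x > 0) \<or> (mdeg g \<le> 1 \<and> (\<forall>x\<in>K. peval g x > 0))"
    and u0: "u0 \<in> K" "c > 0" "\<forall>y\<in>Y. peval (at_y p y) u0 \<le> - c"
    and gstar: "gstar > 0"
    and x: "x \<in> K" "\<And>z. z \<in> K \<Longrightarrow> peval f x / peval g x \<le> peval f z / peval g z"
    and L: "L \<in> dual_feasible g \<phi> s p Y R gstar d k"
    and viol: "\<forall>y\<in>Y. peval (at_y p y) (point_of (\<lambda>h. 1 / L 1 * L h)) \<le> \<epsilon>" and \<epsilon>: "\<epsilon> \<ge> 0"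
  shows "L f \<ge> peval f x / peval g x
    - \<epsilon> * ((peval f u0 - peval f x / peval g x * peval g u0) / (c * gstar))"
proof -
  define r where "r = peval f x / peval g x"
  define F where "F = peval f u0 - r * peval g u0"
  define \<mu> where "\<mu> = L 1"
  define L' where "L' = (\<lambda>h. 1 / \<mu> * L h)"
  define u where "u = point_of L'"
  note norm = dual_feasible_normalize[OF d deg(2) gstar L]
  have l: "0 < \<mu>" "\<mu> \<le> 1 / gstar" using norm by (auto simp: \<mu>_def)
  interpret ball_functional d L' R unfolding L'_def \<mu>_def by (rule norm(3))
  have one: "L' 1 = 1" using l by (simp add: L'_def \<mu>_def)
  have Lg: "L g = 1" and L\<phi>: "\<forall>j\<in>{1..s}. L (\<phi> j) \<le> 0" using L by (auto simp: dual_feasible_def)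
  note jensen = jensen_sos_convex[OF linear d sos_nonneg one]
  have g_le: "g \<in> polys_le (2 * d)" using deg(2) by (simp add: polys_le_def)
  have fu: "\<mu> * peval f u \<le> L f"
    using jensen[of f] deg(1) fg(1) l by (simp add: u_def polys_le_def L'_def field_simps)
  have gu: "1 \<le> \<mu> * peval g u"
  proof -
    have "- peval g u \<le> L' (- g)"
      using jensen[of "- g"] g_le fg(2) by (simp add: u_def polys_le_uminus)
    also have "L' (- g) = - (1 / \<mu>)" using L_uminus[OF g_le] Lg by (simp add: L'_def)
    finally show ?thesis using l by (simp add: field_simps)
  qed
  have phi: "\<forall>j\<in>{1..s}. peval (\<phi> j) u \<le> 0"
  proof
    fix j assume j: "j \<in> {1..s}"
    then have "peval (\<phi> j) u \<le> L' (\<phi> j)"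
      unfolding u_def using conv(1) deg(3)[OF j] by (intro jensen) (auto simp: polys_le_def)
    moreover have "L' (\<phi> j) \<le> 0" using L\<phi> j l by (auto simp: L'_def divide_le_0_iff)
    ultimately show "peval (\<phi> j) u \<le> 0" by simp
  qed
  define t where "t = \<epsilon> / (\<epsilon> + c)"
  define u' where "u' = (1 - t) *\<^sub>R u + t *\<^sub>R u0"
  have t: "0 \<le> t" "t \<le> 1" using \<epsilon> u0(2) by (auto simp: t_def)
  have u': "u' \<in> K"
    unfolding u'_def K
    by (rule feasible_set_repair[OF conv phi _ _ u0(3) \<epsilon> u0(2) t_def])
       (use viol u0(1) in \<open>auto simp: K u_def L'_def \<mu>_def\<close>)
  have g_pos: "peval g z > 0" if "z \<in> K" for z using A2 that by blast
  have r_le: "r * peval g z \<le> peval f z" if "z \<in> K" for z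
    using x(2)[OF that] g_pos[OF that] by (simp add: r_def pos_le_divide_eq)
  have F: "F \<ge> 0" using r_le[OF u0(1)] by (simp add: F_def)
  have rg: "r * ((1 - t) * peval g u + t * peval g u0) \<le> r * peval g u'"
    and rl: "r \<le> r * (\<mu> * peval g u)"
  proof -
    have g_conc: "(1 - t) * peval g u + t * peval g u0 \<le> peval g u'"
      using sos_convex_peval_le[OF fg(2) t, of u u0] by (simp add: u'_def)
    \<comment> \<open>Multiplying the concavity inequalities for g by r needs r \<ge> 0, which the
      first alternative of A2 gives. In the second g is affine, and both become equalities for any
      sign of r.\<close>
    consider "r \<ge> 0" | "mdeg g \<le> 1"
      using A2 x(1) by (fastforce simp: r_def)
    then have "r * ((1 - t) * peval g u + t * peval g u0) \<le> r * peval g u' \<and> r \<le> r * (\<mu> * peval g u)"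
    proof cases
      case 1
      then show ?thesis
        using mult_left_mono[OF g_conc 1] mult_left_mono[OF gu 1] by simp
    next
      case 2
      then have gc: "sos_convex g" by (rule sos_convex_affine)
      have "peval g u' \<le> (1 - t) * peval g u + t * peval g u0"
        using sos_convex_peval_le[OF gc t, of u u0] by (simp add: u'_def)
      then have "peval g u' = (1 - t) * peval g u + t * peval g u0" using g_conc by simp
      moreover have "\<mu> * peval g u \<le> 1"
        using jensen[OF _ g_le gc] Lg l by (simp add: u_def L'_def field_simps)
      then have "\<mu> * peval g u = 1" using gu by simp
      ultimately show ?thesis by simp
    qed
    then show "r * ((1 - t) * peval g u + t * peval g u0) \<le> r * peval g u'"
      "r \<le> r * (\<mu> * peval g u)" by auto
  qed
  have "r * ((1 - t) * peval g u + t * peval g u0) \<le> (1 - t) * peval f u + t * peval f u0"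
    using rg r_le[OF u'] sos_convex_peval_le[OF fg(1) t, of u u0] by (simp add: u'_def)
  then have "0 \<le> (1 - t) * (peval f u - r * peval g u) + t * F"
    by (simp add: F_def algebra_simps)
  \<comment> \<open>Multiplication by \<epsilon> + c turns the weights 1 - t and t into c and
    \<epsilon>.\<close>
  then have "0 \<le> ((1 - t) * (peval f u - r * peval g u) + t * F) * (\<epsilon> + c)"
    using \<epsilon> u0(2) by (intro mult_nonneg_nonneg) auto
  also have "\<dots> = (\<epsilon> + c - t * (\<epsilon> + c)) * (peval f u - r * peval g u) + t * (\<epsilon> + c) * F"
    by (simp add: algebra_simps)
  also have "t * (\<epsilon> + c) = \<epsilon>" using \<epsilon> u0(2) by (simp add: t_def)
  finally have key: "r * peval g u - \<epsilon> * F / c \<le> peval f u"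
    using u0(2) by (simp add: field_simps)
  have "r - \<epsilon> * F / c / gstar \<le> r * (\<mu> * peval g u) - \<mu> * (\<epsilon> * F / c)"
  proof -
    have "\<mu> * (\<epsilon> * F / c) \<le> 1 / gstar * (\<epsilon> * F / c)"
      using l \<epsilon> F u0(2) by (intro mult_right_mono) auto
    moreover have "1 / gstar * (\<epsilon> * F / c) = \<epsilon> * F / c / gstar" by simp
    ultimately show ?thesis using rl by linarith
  qed
  also have "\<dots> = \<mu> * (r * peval g u - \<epsilon> * F / c)" by (simp add: algebra_simps)
  also have "\<dots> \<le> \<mu> * peval f u" using key l by (intro mult_left_mono) auto
  also have "\<dots> \<le> L f" by (rule fu)
  finally show ?thesis by (simp add: r_def F_def)
qed

theorem corollary4p2:
  fixes f g :: "('m::finite, real) mpoly"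
    and \<phi> :: "nat \<Rightarrow> ('m, real) mpoly" and s :: nat
    and p :: "('m, ('n::finite, real) mpoly) mpoly"
    and Y :: "(real ^ 'n) set"
    and K :: "(real ^ 'm) set"
    and R gstar :: real
    and d :: nat
  assumes K_def: "K = feasible_set \<phi> s p Y"
    and d_def: "d = half_degree f g \<phi> s p"
    and d_pos: "1 \<le> d"
    and S_nonempty: "optimal_set f g K \<noteq> {}"
    and R_gstar: "R > 0" "gstar > 0"
      "\<exists>u\<in>optimal_set f g K. norm u \<le> R \<and> peval g u \<ge> gstar"
    and support_Y: "measure_support (density lborel (indicator Y)) = Y"
    and A1_i: "Y \<subseteq> {y. \<forall>i. y $ i \<in> {-1..1}}" "closed Y"
    and A1_ii: "\<forall>j\<in>{1..s}. sos_convex (\<phi> j)" "\<forall>y\<in>Y. sos_convex (at_y p y)"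
    and A2_i: "sos_convex f" "sos_convex (- g)"
    and A2_ii: "(\<forall>x\<in>K. peval f x \<ge> 0 \<and> peval g x > 0) \<or>
                (mdeg g \<le> 1 \<and> (\<forall>x\<in>K. peval g x > 0))"
    and A3: "\<exists>u\<in>K. (\<forall>y\<in>Y. peval (at_y p y) u < 0) \<and> (\<forall>j\<in>{1..s}. peval (\<phi> j) u < 0)"
    and A4: "\<exists>xbar. norm xbar < R \<and> (\<forall>y\<in>Y. peval (at_y p y) xbar < 0)"
    and A5: "\<exists>\<epsilon>Y>0. \<exists>\<eta>Y>0. \<forall>y\<in>Y. \<forall>\<delta>. 0 < \<delta> \<and> \<delta> < \<epsilon>Y \<longrightarrow>
               measure lborel (cball y \<delta> \<inter> Y) \<ge> \<eta>Y * measure lborel (cball y \<delta>)"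
  shows "(\<exists>C k0. \<forall>k\<ge>k0. \<forall>u\<in>Lambda \<phi> s p Y R d k.
            infdist u (K \<inter> cball 0 R) \<le> C * (ln (real k) / real k)) \<and>
         (\<forall>k. 0 \<le> optimal_value f g K - r_dual f g \<phi> s p Y R gstar d k) \<and>
         (\<exists>C k0. \<forall>k\<ge>k0. optimal_value f g K - r_dual f g \<phi> s p Y R gstar d k
            \<le> ereal (C * (ln (real k) / real k)))"
proof -
  have Y: "compact Y"
  proof -
    have "Y \<subseteq> cbox (\<chi> i. -1) (\<chi> i. 1)"
      using A1_i(1) by (auto simp: mem_box_cart)
    then show ?thesis
      using A1_i(2) bounded_subset[OF bounded_cbox] by (auto simp: compact_eq_bounded_closed)
  qed
  note deg = half_degree_bounds[OF d_def]
  obtain x where x: "x \<in> optimal_set f g K" "norm x \<le> R" "peval g x \<ge> gstar"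
    using R_gstar(3) by blast
  have xK: "x \<in> K" and x_min: "\<And>z. z \<in> K \<Longrightarrow> peval f x / peval g x \<le> peval f z / peval g z"
    using x(1) by (auto simp: optimal_set_def)
  obtain u0 where u0: "u0 \<in> K" "\<forall>y\<in>Y. peval (at_y p y) u0 < 0" using A3 by blast
  obtain c where c: "c > 0" "\<forall>y\<in>Y. peval (at_y p y) u0 \<le> - c"
    using slater_gap[OF Y, of p u0] u0(2) by blast
  obtain C k0 where C: "C \<ge> 0" "\<And>k L. k \<ge> k0 \<Longrightarrow> ball_functional d L R \<Longrightarrow> L 1 = 1 \<Longrightarrow>
      - apply_x L p \<in> Pk (mdeg_y p) Y k \<Longrightarrow>
      \<forall>y\<in>Y. peval (at_y p y) (point_of L) \<le> C * (ln (real k) / real k)\<^sup>2"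
    using constraint_violation[OF Y deg(3) A1_ii(2) A5, of R] by blast

  have part1: "\<exists>C k0. \<forall>k\<ge>k0. \<forall>u\<in>Lambda \<phi> s p Y R d k.
            infdist u (K \<inter> cball 0 R) \<le> C * (ln (real k) / real k)"
    unfolding K_def
    by (rule infdist_Lambda_rate[OF Y d_pos R_gstar(1) deg(3,4) A1_ii u0(1)[unfolded K_def] c
          xK[unfolded K_def] x(2) C])

  define r where "r = peval f x / peval g x"
  have opt: "optimal_value f g K = ereal r"
    unfolding optimal_value_def r_def
    by (intro antisym INF_lower xK INF_greatest) (auto intro: x_min)
  have r_dual_le: "r_dual f g \<phi> s p Y R gstar d k \<le> ereal r" for k
    unfolding r_dual_altdef r_def
    using scaled_peval_dual_feasible[OF xK[unfolded K_def] x(2,3) R_gstar(2)]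
    by (rule INF_lower2) simp
  have part2: "\<forall>k. 0 \<le> optimal_value f g K - r_dual f g \<phi> s p Y R gstar d k"
    unfolding opt using r_dual_le by (auto intro: ereal_diff_positive)

  define E where "E = (peval f u0 - r * peval g u0) / (c * gstar)"
  have E: "E \<ge> 0"
  proof -
    have "peval g u0 > 0" using A2_ii u0(1) by blast
    then have "r * peval g u0 \<le> peval f u0"
      using x_min[OF u0(1)] by (simp add: r_def pos_le_divide_eq)
    then show ?thesis using c(1) R_gstar(2) by (simp add: E_def)
  qed
  obtain k1 where k1: "\<And>k. k \<ge> k1 \<Longrightarrow> 0 \<le> ln (real k) / real k \<and> ln (real k) / real k \<le> 1"
    using eventually_rate_le[of 0] by auto
  have part3: "optimal_value f g K - r_dual f g \<phi> s p Y R gstar d k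
      \<le> ereal (C * E * (ln (real k) / real k))" if k: "k \<ge> max k0 k1" for k
  proof -
    define q where "q = ln (real k) / real k"
    have q: "0 \<le> q" "q \<le> 1" using k1[of k] k by (auto simp: q_def)
    have "ereal (r - C * E * q) \<le> ereal (L f)" if L: "L \<in> dual_feasible g \<phi> s p Y R gstar d k" for L
    proof -
      note norm = dual_feasible_normalize[OF d_pos deg(2) R_gstar(2) L]
      have viol: "\<forall>y\<in>Y. peval (at_y p y) (point_of (\<lambda>h. 1 / L 1 * L h)) \<le> C * q\<^sup>2"
        unfolding q_def by (rule C(2)) (use k norm in auto)
      have "L f \<ge> r - C * q\<^sup>2 * E"
        using dual_feasible_rate[OF d_pos deg(1,2,4) K_def A1_ii A2_i A2_ii u0(1) c R_gstar(2)
            xK x_min L viol] C(1) by (simp add: r_def E_def)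
      \<comment> \<open>The values converge at the rate q^2; since q \<le> 1 this is weakened to the
        rate q claimed.\<close>
      moreover have "C * E * q\<^sup>2 \<le> C * E * q"
        using C(1) E q by (intro mult_left_mono) (auto simp: power2_eq_square mult_left_le)
      ultimately show ?thesis by (simp add: algebra_simps)
    qed
    then have "ereal (r - C * E * q) \<le> r_dual f g \<phi> s p Y R gstar d k"
      unfolding r_dual_altdef by (rule INF_greatest)
    \<comment> \<open>In the extended reals the lower bound just shown excludes the value minus
      infinity, for which the difference would be infinite.\<close>
    then show ?thesis
      unfolding opt q_def[symmetric]
      by (cases "r_dual f g \<phi> s p Y R gstar d k") auto
  qed
  show ?thesis using part1 part2 part3 by blast
qed

end
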